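(* Suppose that: (A1) $\Xi$ is compact; (A2) $c(f(\theta;x);y)$ is Lipschitz smooth in $\theta$ and $\xi=(x,y)$ with constants $L_{\theta\theta},L_{\theta\xi},L_{\xi\theta},L_{\xi\xi}$ (as in the context); (A3) $h(\theta,\gamma;\xi,\xi')$ is $\mu_h$-strongly concave in $\xi'$; (A4) for all $(\theta,\gamma)$, $$\mathbb{E}_Q[\|\nabla_{\theta}H(\theta,\gamma)-\nabla_{\theta}h^{\star}(\theta,\gamma;\xi)\|^2]\le \sigma_{\theta}^2,\qquad \mathbb{E}_Q[\|\nabla_{\gamma}H(\theta,\gamma)-\nabla_{\gamma}h^{\star}(\theta,\gamma;\xi)\|^2]\le \sigma_{\gamma}^2,$$ and $H(\theta_0,\gamma_0)-\inf_{\theta,\gamma}H(\theta,\gamma)\le \Lambda$ for a constant $\Lambda>0$. Let $L_1=\frac{L_{\xi\gamma}}{\mu_h}$, $L_2=\frac{L_{\xi\theta}}{\mu_h}$, $L_3=\frac{L_{\theta\xi}L_{\xi\gamma}}{\mu_h}$, $L_4=L_{\theta\theta}+\frac{L_{\theta\xi}L_{\xi\theta}}{\mu_h}$ and $L^2=\max(L_1^2+L_3^2+L_1L_2+L_3L_4,\;L_2^2+L_4^2+L_1L_2+L_3L_4)$. Run the DA-SGD algorithm (described in the context) for $T$ iterations with constant step sizes $\alpha=\beta=\sqrt{\frac{\Lambda}{L(\sigma_{\theta}^2+\sigma_{\gamma}^2)T}}$ and inner accuracy $\varepsilon=\frac{\mu_h}{(L_{\theta\xi}^2+1)\sqrt{T}}$.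 Then $$\frac{1}{T}\sum_{t=0}^{T-1}\mathbb{E}_Q\big[\|\nabla_{\theta}H(\theta_t,\gamma_t)\|_2^2+\|\nabla_{\gamma}H(\theta_t,\gamma_t)\|_2^2\big]\le \Big(4\sqrt{L(\sigma_{\theta}^2+\sigma_{\gamma}^2)\Lambda}+2\Big)\sqrt{\frac1T}+2\sqrt{\frac{L\Lambda}{\sigma_{\theta}^2+\sigma_{\gamma}^2}}\,\frac1T .$$
   Context: Points of $\Xi\subset\mathbb{R}^p\times\mathbb{R}^m$ are written $\xi=(x,y)$ ($x$ covariates, $y$ uncertain parameters); $\Theta\subset\mathbb{R}^k$; $f(\theta;x)$ is a decision policy with parameter $\theta\in\Theta$; $c(z;y)$ is a real-valued cost of decision $z$. $Q$ is a probability distribution on $\Xi$ (the nominal distribution) and $\rho>0$ a radius. The transport cost is $d(\xi,\xi')=\|x-x'\|_2+\kappa\|y-y'\|_2$ with $\kappa\in(0,\infty]$; the paper sets $\kappa=\infty$ (with $\infty\cdot 0=0$), so that $d(\xi,\xi')=\infty$ unless $y=y'$, i.e. only the $x$-component can be moved. On the $\xi$-space use $\|v\|=\|v_x\|_2+\kappa\|v_y\|_2$, so $d(\xi,\xi')=\|\xi-\xi'\|$, with dual $\|g\|_*=\max\{\|g_x\|_2,\kappa^{-1}\|g_y\|_2\}$; on $\theta$ and $\gamma$ use Euclidean norms (self-dual). For $\theta\in\Theta,\gamma>0$ define $$h(\theta,\gamma;\xi,\xi')=c(f(\theta;x');y')-\gamma d(\xi',\xi)+\gamma\rho,\quad h^{\star}(\theta,\gamma;\xi)=\sup_{\xi'\in\Xi}h(\theta,\gamma;\xi,\xi'),\quad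 H(\theta,\gamma)=\mathbb{E}_{\xi\sim Q}[h^{\star}(\theta,\gamma;\xi)].$$ Lipschitz smoothness: with $\ell(\theta,\xi)=c(f(\theta;x);y)$, for all $\theta,\theta',\xi,\xi'$: $\|\nabla_\theta\ell(\theta,\xi)-\nabla_\theta\ell(\theta',\xi)\|_*\le L_{\theta\theta}\|\theta-\theta'\|$, $\|\nabla_\theta\ell(\theta,\xi)-\nabla_\theta\ell(\theta,\xi')\|_*\le L_{\theta\xi}\|\xi-\xi'\|$, $\|\nabla_\xi\ell(\theta,\xi)-\nabla_\xi\ell(\theta',\xi)\|_*\le L_{\xi\theta}\|\theta-\theta'\|$, $\|\nabla_\xi\ell(\theta,\xi)-\nabla_\xi\ell(\theta,\xi')\|_*\le L_{\xi\xi}\|\xi-\xi'\|$. $L_{\xi\gamma}$ denotes the Lipschitz constant of $\nabla_{\xi'}h(\theta,\gamma;\xi,\xi')$ in $\gamma$ (in the norm $\|\cdot\|_*$). $h^\star(\theta,\gamma;\xi)$ is taken to be differentiable in $(\theta,\gamma)$. DA-SGD algorithm: start from $(\theta_0,\gamma_0)$. For $t=0,\dots,T-1$: draw $\xi_t\sim Q$ independently of the past; compute (by gradient ascent in $\xi'$) an $\varepsilon$-maximizer $\hat\xi_t^\star=(\hat x_t^\star,\hat y_t^\star)$ of $\xi'\mapsto h(\theta_t,\gamma_t;\xi_t,\xi')$, i.e. $|h^\star(\theta_t,\gamma_t;\xi_t)-h(\theta_t,\gamma_t;\xi_t,\hat\xi_t^\star)|\le\varepsilon$; set $\theta_{t+1}=\theta_t-\alpha\nabla_\theta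 c(f(\theta_t;\hat x_t^\star);\hat y_t^\star)$ and $\gamma_{t+1}=\gamma_t-\beta[\rho-d(\hat\xi_t^\star,\xi_t)]$. The iterates are understood to stay in the domain $\Theta\times(0,\infty)$ of $H$. $\mathbb{E}_Q$ of quantities depending on iterates is expectation over the draws $\xi_t\sim Q$.
   Formalization: The formal theorem additionally assumes that the step size satisfies α ≤ 1/L (i.e. T ≥ LΛ/(σ_θ²+σ_γ²)), that Θ is convex with nonempty interior, and that L and σ_θ²+σ_γ² are positive; the bound fails or is ill-defined in general without these. *)

theory Defs
  imports "HOL-Probability.Probability"
begin

text \<open>
  The parameter \<open>\<kappa>\<close> is an extended real in \<open>(0, \<infinity>]\<close>.  In \<^typ>\<open>ereal\<close> we have \<open>\<infinity> * 0 = 0\<close> and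
  \<open>inverse \<infinity> = 0\<close>, so for \<open>\<kappa> = \<infinity>\<close> the norm below is infinite unless the second component
  vanishes, and the dual norm only sees the first component.
\<close>

definition xnorm :: "ereal \<Rightarrow> 'a::real_normed_vector \<times> 'b::real_normed_vector \<Rightarrow> ereal" where
  "xnorm \<kappa> v = ereal (norm (fst v)) + \<kappa> * ereal (norm (snd v))"

definition xnorm_dual :: "ereal \<Rightarrow> 'a::real_normed_vector \<times> 'b::real_normed_vector \<Rightarrow> ereal" where
  "xnorm_dual \<kappa> g = max (ereal (norm (fst g))) (inverse \<kappa> * ereal (norm (snd g)))"

definition tcost ::
    "ereal \<Rightarrow> 'a::real_normed_vector \<times> 'b::real_normed_vector \<Rightarrow> 'a \<times> 'b \<Rightarrow> ereal" where
  "tcost \<kappa> \<xi> \<xi>' = xnorm \<kappa> (\<xi> - \<xi>')"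

definition loss :: "('t \<Rightarrow> 'x \<Rightarrow> 'z) \<Rightarrow> ('z \<Rightarrow> 'y \<Rightarrow> real) \<Rightarrow> 't \<Rightarrow> 'x \<times> 'y \<Rightarrow> real" where
  "loss f c \<theta> \<xi> = c (f \<theta> (fst \<xi>)) (snd \<xi>)"

text \<open>
  In the following, \<open>l\<close> is the loss \<open>l \<theta> \<xi> = c (f \<theta> x) y\<close>.  The function \<open>hfun\<close> takes the value
  \<open>-\<infinity>\<close> exactly where the transport cost is infinite.
\<close>

definition hfun ::
    "ereal \<Rightarrow> real \<Rightarrow> ('t \<Rightarrow> 'a::real_normed_vector \<times> 'b::real_normed_vector \<Rightarrow> real)
      \<Rightarrow> 't \<Rightarrow> real \<Rightarrow> 'a \<times> 'b \<Rightarrow> 'a \<times> 'b \<Rightarrow> ereal" where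
  "hfun \<kappa> \<rho> l \<theta> \<gamma> \<xi> \<xi>' = ereal (l \<theta> \<xi>') - ereal \<gamma> * tcost \<kappa> \<xi>' \<xi> + ereal (\<gamma> * \<rho>)"

definition hstar ::
    "ereal \<Rightarrow> real \<Rightarrow> ('a::real_normed_vector \<times> 'b::real_normed_vector) set
      \<Rightarrow> ('t \<Rightarrow> 'a \<times> 'b \<Rightarrow> real) \<Rightarrow> 't \<Rightarrow> real \<Rightarrow> 'a \<times> 'b \<Rightarrow> ereal" where
  "hstar \<kappa> \<rho> \<Xi> l \<theta> \<gamma> \<xi> = (SUP \<xi>'\<in>\<Xi>. hfun \<kappa> \<rho> l \<theta> \<gamma> \<xi> \<xi>')"

text \<open>
  For \<open>\<Xi>\<close> compact, \<open>l \<theta>\<close> continuous on \<open>\<Xi>\<close>, \<open>\<gamma> > 0\<close> and \<open>\<xi> \<in> \<Xi>\<close> the value of \<open>hstar\<close> is finite,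
  so that the conversion to \<^typ>\<open>real\<close> loses nothing.
\<close>

definition rhstar ::
    "ereal \<Rightarrow> real \<Rightarrow> ('a::real_normed_vector \<times> 'b::real_normed_vector) set
      \<Rightarrow> ('t \<Rightarrow> 'a \<times> 'b \<Rightarrow> real) \<Rightarrow> 't \<Rightarrow> real \<Rightarrow> 'a \<times> 'b \<Rightarrow> real" where
  "rhstar \<kappa> \<rho> \<Xi> l \<theta> \<gamma> \<xi> = real_of_ereal (hstar \<kappa> \<rho> \<Xi> l \<theta> \<gamma> \<xi>)"

definition Hfun ::
    "('a::real_normed_vector \<times> 'b::real_normed_vector) measure \<Rightarrow> ereal \<Rightarrow> real \<Rightarrow> ('a \<times> 'b) set
      \<Rightarrow> ('t \<Rightarrow> 'a \<times> 'b \<Rightarrow> real) \<Rightarrow> 't \<Rightarrow> real \<Rightarrow> real" where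
  "Hfun Q \<kappa> \<rho> \<Xi> l \<theta> \<gamma> = (\<integral>\<xi>. rhstar \<kappa> \<rho> \<Xi> l \<theta> \<gamma> \<xi> \<partial>Q)"

definition has_gradient_within :: "('a::real_inner \<Rightarrow> real) \<Rightarrow> 'a \<Rightarrow> 'a set \<Rightarrow> 'a \<Rightarrow> bool" where
  "has_gradient_within F g S x \<longleftrightarrow> (F has_derivative (\<lambda>v. g \<bullet> v)) (at x within S)"

text \<open>
  Meant for sets \<open>S\<close> in which derivatives are unique (such as open sets, or convex sets with
  nonempty interior).
\<close>

definition grad_within :: "('a::real_inner \<Rightarrow> real) \<Rightarrow> 'a set \<Rightarrow> 'a \<Rightarrow> 'a" where
  "grad_within F S x = (THE g. has_gradient_within F g S x)"

text \<open>
  Lipschitz smoothness of \<open>l\<close> on \<open>\<Theta> \<times> \<Xi>\<close>.  The set \<open>\<Xi>\<close> may be lower-dimensional or have discrete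
  second components, so gradients in \<open>\<xi>\<close> are taken within \<open>\<Xi>\<close> and need not be unique; therefore
  a gradient field is asserted to exist.  A bound by an infinite \<open>xnorm\<close> is no
  condition at all, also when the Lipschitz constant is \<open>0\<close>; hence the finiteness premises.
\<close>

definition lipschitz_smooth ::
    "ereal \<Rightarrow> 't::real_inner set \<Rightarrow> ('a::real_inner \<times> 'b::real_inner) set
      \<Rightarrow> ('t \<Rightarrow> 'a \<times> 'b \<Rightarrow> real) \<Rightarrow> real \<Rightarrow> real \<Rightarrow> real \<Rightarrow> real \<Rightarrow> bool" where
  "lipschitz_smooth \<kappa> \<Theta> \<Xi> l Ltt Ltx Lxt Lxx \<longleftrightarrow>
     0 \<le> Ltt \<and> 0 \<le> Ltx \<and> 0 \<le> Lxt \<and> 0 \<le> Lxx \<and>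
     (\<exists>gt gx.
        (\<forall>\<theta>\<in>\<Theta>. \<forall>\<xi>\<in>\<Xi>. has_gradient_within (\<lambda>\<theta>. l \<theta> \<xi>) (gt \<theta> \<xi>) \<Theta> \<theta> \<and>
                       has_gradient_within (\<lambda>\<xi>. l \<theta> \<xi>) (gx \<theta> \<xi>) \<Xi> \<xi>) \<and>
        (\<forall>\<theta>\<in>\<Theta>. \<forall>\<theta>'\<in>\<Theta>. \<forall>\<xi>\<in>\<Xi>. norm (gt \<theta> \<xi> - gt \<theta>' \<xi>) \<le> Ltt * norm (\<theta> - \<theta>')) \<and>
        (\<forall>\<theta>\<in>\<Theta>. \<forall>\<xi>\<in>\<Xi>. \<forall>\<xi>'\<in>\<Xi>. xnorm \<kappa> (\<xi> - \<xi>') < \<infinity> \<longrightarrow>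
            ereal (norm (gt \<theta> \<xi> - gt \<theta> \<xi>')) \<le> ereal Ltx * xnorm \<kappa> (\<xi> - \<xi>')) \<and>
        (\<forall>\<theta>\<in>\<Theta>. \<forall>\<theta>'\<in>\<Theta>. \<forall>\<xi>\<in>\<Xi>.
            xnorm_dual \<kappa> (gx \<theta> \<xi> - gx \<theta>' \<xi>) \<le> ereal (Lxt * norm (\<theta> - \<theta>'))) \<and>
        (\<forall>\<theta>\<in>\<Theta>. \<forall>\<xi>\<in>\<Xi>. \<forall>\<xi>'\<in>\<Xi>. xnorm \<kappa> (\<xi> - \<xi>') < \<infinity> \<longrightarrow>
            xnorm_dual \<kappa> (gx \<theta> \<xi> - gx \<theta> \<xi>') \<le> ereal Lxx * xnorm \<kappa> (\<xi> - \<xi>')))"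

text \<open>
  Strong concavity, with respect to \<open>xnorm \<kappa>\<close>, of an extended-valued function with values in
  \<open>[-\<infinity>, \<infinity>)\<close>: the defining inequality is required on the effective domain, which has to be convex.
\<close>

definition strongly_concave_on ::
    "ereal \<Rightarrow> real \<Rightarrow> ('a::real_normed_vector \<times> 'b::real_normed_vector) set
      \<Rightarrow> ('a \<times> 'b \<Rightarrow> ereal) \<Rightarrow> bool" where
  "strongly_concave_on \<kappa> \<mu> S F \<longleftrightarrow>
     convex {u\<in>S. F u \<noteq> -\<infinity>} \<and>
     (\<forall>u\<in>{u\<in>S. F u \<noteq> -\<infinity>}. \<forall>v\<in>{u\<in>S. F u \<noteq> -\<infinity>}. \<forall>s\<in>{0..1}.
        ereal (1 - s) * F u + ereal s * F v + ereal (\<mu> / 2 * s * (1 - s)) * (xnorm \<kappa> (u - v))\<^sup>2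
          \<le> F ((1 - s) *\<^sub>R u + s *\<^sub>R v))"

text \<open>
  Lipschitz continuity in \<open>\<gamma>\<close>, in the dual norm, of the gradient of \<open>hfun\<close> in its last argument.
  The transport cost has kinks, so only points of differentiability are considered.  Gradients are
  taken within the effective domain, where again they may be non-unique.
\<close>

definition grad_h_lipschitz_gamma ::
    "ereal \<Rightarrow> real \<Rightarrow> 't set \<Rightarrow> ('a::real_inner \<times> 'b::real_inner) set
      \<Rightarrow> ('t \<Rightarrow> 'a \<times> 'b \<Rightarrow> real) \<Rightarrow> real \<Rightarrow> bool" where
  "grad_h_lipschitz_gamma \<kappa> \<rho> \<Theta> \<Xi> l Lxg \<longleftrightarrow>
     0 \<le> Lxg \<and>
     (\<forall>\<theta>\<in>\<Theta>. \<forall>\<gamma>>0. \<forall>\<gamma>'>0. \<forall>\<xi>\<in>\<Xi>.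
        let S = {\<xi>'\<in>\<Xi>. tcost \<kappa> \<xi>' \<xi> < \<infinity>};
            F = (\<lambda>\<gamma> \<xi>'. real_of_ereal (hfun \<kappa> \<rho> l \<theta> \<gamma> \<xi> \<xi>'))
        in \<forall>\<xi>'\<in>S. F \<gamma> differentiable (at \<xi>' within S) \<longrightarrow> F \<gamma>' differentiable (at \<xi>' within S) \<longrightarrow>
             (\<exists>g g'. has_gradient_within (F \<gamma>) g S \<xi>' \<and> has_gradient_within (F \<gamma>') g' S \<xi>' \<and>
                     xnorm_dual \<kappa> (g - g') \<le> ereal (Lxg * \<bar>\<gamma> - \<gamma>'\<bar>)))"

text \<open>
  A run of the algorithm on a probability space \<open>M\<close> over \<open>T\<close> steps: \<open>X t\<close> is the sample drawn in
  step \<open>t\<close>, \<open>Xh t\<close> the approximate maximizer, and \<open>th t\<close>, \<open>ga t\<close> are the iterates.  The maximizer may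
  be any random variable, possibly using extra randomness.  The past of step \<open>t\<close> consists
  of the iterates up to \<open>t\<close> and of the samples and approximate maximizers before \<open>t\<close>.
  The accuracy condition is an inequality in \<^typ>\<open>ereal\<close>, so it forces the transport
  cost from the sample to the approximate maximizer to be finite.
\<close>

definition da_sgd_run ::
    "'w measure \<Rightarrow> ('a::euclidean_space \<times> 'b::euclidean_space) measure \<Rightarrow> ereal \<Rightarrow> real
      \<Rightarrow> 't::euclidean_space set \<Rightarrow> ('a \<times> 'b) set \<Rightarrow> ('t \<Rightarrow> 'a \<times> 'b \<Rightarrow> real)
      \<Rightarrow> real \<Rightarrow> real \<Rightarrow> real \<Rightarrow> nat \<Rightarrow> 't \<Rightarrow> real
      \<Rightarrow> (nat \<Rightarrow> 'w \<Rightarrow> 'a \<times> 'b) \<Rightarrow> (nat \<Rightarrow> 'w \<Rightarrow> 'a \<times> 'b)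
      \<Rightarrow> (nat \<Rightarrow> 'w \<Rightarrow> 't) \<Rightarrow> (nat \<Rightarrow> 'w \<Rightarrow> real) \<Rightarrow> bool" where
  "da_sgd_run M Q \<kappa> \<rho> \<Theta> \<Xi> l \<alpha> \<beta> \<epsilon> T \<theta>0 \<gamma>0 X Xh th ga \<longleftrightarrow>
     prob_space M \<and>
     (\<forall>t\<le>T. th t \<in> borel_measurable M \<and> ga t \<in> borel_measurable M) \<and>
     (\<forall>t<T. X t \<in> measurable M Q \<and> Xh t \<in> measurable M Q) \<and>
     (\<forall>t<T. distr M Q (X t) = Q) \<and>
     (\<forall>t<T. prob_space.indep_set M
        (sets (vimage_algebra (space M)
           (\<lambda>\<omega>. (\<lambda>s\<in>{..t}. (th s \<omega>, ga s \<omega>), \<lambda>s\<in>{..<t}. (X s \<omega>, Xh s \<omega>)))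
           (PiM {..t} (\<lambda>_. borel \<Otimes>\<^sub>M borel) \<Otimes>\<^sub>M PiM {..<t} (\<lambda>_. Q \<Otimes>\<^sub>M Q))))
        (sets (vimage_algebra (space M) (X t) Q))) \<and>
     (\<forall>\<omega>\<in>space M.
        th 0 \<omega> = \<theta>0 \<and> ga 0 \<omega> = \<gamma>0 \<and>
        (\<forall>t\<le>T. th t \<omega> \<in> \<Theta> \<and> 0 < ga t \<omega>) \<and>
        (\<forall>t<T.
           \<bar>hstar \<kappa> \<rho> \<Xi> l (th t \<omega>) (ga t \<omega>) (X t \<omega>)
              - hfun \<kappa> \<rho> l (th t \<omega>) (ga t \<omega>) (X t \<omega>) (Xh t \<omega>)\<bar> \<le> ereal \<epsilon> \<and>
           th (Suc t) \<omega> = th t \<omega> - \<alpha> *\<^sub>R grad_within (\<lambda>\<theta>. l \<theta> (Xh t \<omega>)) \<Theta> (th t \<omega>) \<and>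
           ga (Suc t) \<omega> = ga t \<omega> - \<beta> * (\<rho> - real_of_ereal (tcost \<kappa> (Xh t \<omega>) (X t \<omega>)))))"

end

theory Submission
  imports Defs
begin

text \<open>
  Strong concavity makes the inner maximizer \<open>u(\<theta>, \<gamma>, \<xi>)\<close> unique and Lipschitz in \<open>(\<theta>, \<gamma>)\<close> with
  constants \<open>L2\<close>, \<open>L1\<close>; by Danskin's theorem the gradient of \<open>h\<^sup>\<star>(\<cdot>; \<xi>)\<close> is
  \<open>(\<nabla>\<^sub>\<theta> l(\<theta>, u), \<rho> - d(u, \<xi>))\<close>, which is therefore Lipschitz with constant \<open>L\<close>, and so is its mean \<open>\<nabla>H\<close>.
  By quadratic growth at the maximizer, an \<open>\<epsilon>\<close>-maximizer produces a gradient error \<open>e\<close> with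
  \<open>\<parallel>e\<parallel>\<^sup>2 \<le> \<delta> := 2 (Ltx\<^sup>2 + 1) \<epsilon> / \<mu> = 2 / \<surd>T\<close>.  With noise \<open>n\<close> of mean zero and variance at most
  \<open>\<sigma>\<^sup>2 = \<sigma>t\<^sup>2 + \<sigma>g\<^sup>2\<close>, the descent inequality for a step \<open>- \<alpha> (\<nabla>H + n + e)\<close> gives, as \<open>\<alpha> L \<le> 1\<close>,
  \<open>E \<parallel>\<nabla>H\<parallel>\<^sup>2 \<le> 2 E (H(w\<^sub>t) - H(w\<^bsub>t+1\<^esub>)) / \<alpha> + \<delta> + 2 L \<alpha> \<sigma>\<^sup>2 + L \<alpha> \<delta>\<close>, and it remains to telescope.
\<close>

section \<open>Gradients on convex sets\<close>

text \<open>The transport cost has a kink where the point is not moved, and \<open>\<Xi>\<close> may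
  be thin, so first-order optimality of the maximizer is no convenient tool. Its stability comes
  from comparing function values: adding the growth inequalities of two maximizers leaves only
  differences of losses and of transport costs. This yields the factor 1/\<mu> for a change of
  \<gamma>, whereas the constants of the theorem ask for \<open>Lxg / \<mu>\<close>; the bound
  \<open>1 \<le> Lxg\<close>, valid wherever anything besides \<xi> can be reached, closes the gap.
  The gradient of the optimal value is found in two rounds: a sandwich with a crude constant
  identifies it, then its Lipschitz bound gives the quadratic bound with \<open>L / 2\<close>. The
  maximizer is picked by choice and carries no measurability in \<xi>. Measurability is shown for
  the optimal value and passed to its gradient through difference quotients. Integrability along the
  run follows from deterministic bounds on the iterates that depend on the step. The case \<kappa> =
  \<infinity> is covered by working on the points at finite cost, whose convexity is part of strong
  concavity.\<close>

lemma has_real_derivative_along_segment: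
  fixes F :: "'a::real_inner \<Rightarrow> real"
  assumes "convex S" "x \<in> S" "y \<in> S" "s \<in> {0..1}"
    and "has_gradient_within F g S (x + s *\<^sub>R (y - x))"
  shows "((\<lambda>s. F (x + s *\<^sub>R (y - x))) has_real_derivative g \<bullet> (y - x)) (at s within {0..1})"
proof -
  have "(\<lambda>s. x + s *\<^sub>R (y - x)) ` {0..1} \<subseteq> S"
  proof clarify
    fix s :: real assume s: "s \<in> {0..1}"
    have "x + s *\<^sub>R (y - x) = (1 - s) *\<^sub>R x + s *\<^sub>R y" by (simp add: algebra_simps)
    then show "x + s *\<^sub>R (y - x) \<in> S" using assms(1-3) s by (simp add: convex_alt)
  qed
  then have "(F has_derivative (\<lambda>v. g \<bullet> v))
      (at (x + s *\<^sub>R (y - x)) within (\<lambda>s. x + s *\<^sub>R (y - x)) ` {0..1})"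
    using assms(5) unfolding has_gradient_within_def by (rule has_derivative_subset[rotated])
  moreover have "((\<lambda>s. x + s *\<^sub>R (y - x)) has_derivative (\<lambda>h. h *\<^sub>R (y - x))) (at s within {0..1})"
    by (auto intro!: derivative_eq_intros)
  ultimately have "((\<lambda>s. F (x + s *\<^sub>R (y - x))) has_derivative (\<lambda>h. g \<bullet> (h *\<^sub>R (y - x))))
      (at s within {0..1})"
    using has_derivative_in_compose[of "\<lambda>s. x + s *\<^sub>R (y - x)" "\<lambda>h. h *\<^sub>R (y - x)" s "{0..1}" F]
    by blast
  then show ?thesis
    by (simp add: has_field_derivative_def mult.commute[of _ "g \<bullet> (y - x)"])
qed

lemma has_gradient_within_diff:
  assumes "has_gradient_within F g S x" "has_gradient_within F' g' S x"
  shows "has_gradient_within (\<lambda>x. F x - F' x) (g - g') S x"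
  using has_derivative_diff[OF assms[unfolded has_gradient_within_def]]
  by (simp add: has_gradient_within_def inner_diff_left)

lemma DERIV_unique_Icc_0:
  fixes f :: "real \<Rightarrow> real"
  assumes "(f has_real_derivative a) (at 0 within {0..1})" "(f has_real_derivative b) (at 0 within {0..1})"
  shows "a = b"
  using vector_derivative_unique_within_closed_interval[of 0 1 0 f a b] assms
  by (simp add: has_real_derivative_iff_has_vector_derivative)

text \<open>A ball in \<open>S\<close> contains its centre \<open>w\<close> and a point displaced
  from \<open>w\<close> along \<open>g\<close>. Subtracting the conditions at these two points
  eliminates \<open>x\<close> and leaves a positive multiple of the squared norm of
  \<open>g\<close>.\<close>

lemma eq_0_if_orthogonal_to_differences:
  fixes g :: "'a::real_inner"
  assumes "interior S \<noteq> {}" "\<And>y. y \<in> S \<Longrightarrow> g \<bullet> (y - x) = 0"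
  shows "g = 0"
proof (rule ccontr)
  assume g: "g \<noteq> 0"
  obtain w e where w: "ball w e \<subseteq> S" "e > 0"
    using assms(1) by (meson ex_in_conv mem_interior)
  define y where "y = w + (e / 2 / norm g) *\<^sub>R g"
  have "y \<in> ball w e" using w g by (simp add: y_def dist_norm)
  then have "y \<in> S" using w(1) by blast
  then have "g \<bullet> (y - x) = 0" by (rule assms(2))
  moreover have "w \<in> S" using w by (intro subsetD[OF w(1)]) simp
  then have "g \<bullet> (w - x) = 0" by (rule assms(2))
  ultimately have "g \<bullet> (y - w) = 0" by (simp add: inner_diff_right)
  then show False using g w by (simp add: y_def)
qed

text \<open>Since \<open>x\<close> may be a boundary point, only one-sided derivatives along
  segments into \<open>S\<close> are available. They are taken of the zero function
  \<open>F - F\<close>, which has gradient \<open>g - g'\<close>; the interior of \<open>S\<close>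
  supplies enough directions.\<close>

lemma has_gradient_within_unique:
  fixes F :: "'a::real_inner \<Rightarrow> real"
  assumes S: "convex S" "interior S \<noteq> {}" "x \<in> S"
    and "has_gradient_within F g S x" "has_gradient_within F g' S x"
  shows "g = g'"
proof -
  have "(g - g') \<bullet> (y - x) = 0" if "y \<in> S" for y
  proof (rule DERIV_unique_Icc_0)
    show "((\<lambda>s. 0) has_real_derivative (g - g') \<bullet> (y - x)) (at 0 within {0..1})"
      using has_real_derivative_along_segment[OF S(1,3) that, of 0 "\<lambda>x. F x - F x" "g - g'"]
        has_gradient_within_diff[OF assms(4,5)] by simp
  qed simp
  from eq_0_if_orthogonal_to_differences[OF S(2) this] show ?thesis by simp
qed

lemma grad_within_eqI:
  fixes F :: "'a::real_inner \<Rightarrow> real"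
  assumes "convex S" "interior S \<noteq> {}" "x \<in> S" "has_gradient_within F g S x"
  shows "grad_within F S x = g"
  unfolding grad_within_def
  using assms has_gradient_within_unique by (intro the_equality) blast+

lemma has_gradient_withinI_quadratic:
  fixes F :: "'a::real_inner \<Rightarrow> real"
  assumes "\<And>y. y \<in> S \<Longrightarrow> \<bar>F y - F x - g \<bullet> (y - x)\<bar> \<le> C * (norm (y - x))\<^sup>2"
  shows "has_gradient_within F g S x"
  unfolding has_gradient_within_def has_derivative_within_alt
proof (intro conjI allI impI)
  show "bounded_linear ((\<bullet>) g)" by (rule bounded_linear_inner_right)
  fix e :: real assume e: "e > 0"
  show "\<exists>d>0. \<forall>y\<in>S. norm (y - x) < d \<longrightarrow> norm (F y - F x - g \<bullet> (y - x)) \<le> e * norm (y - x)"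
  \<comment> \<open>No sign is assumed for \<open>C\<close>; the denominator
    \<open>\<bar>C\<bar> + 1\<close> is positive and dominates it.\<close>
  proof (intro exI[of _ "e / (\<bar>C\<bar> + 1)"] conjI ballI impI)
    show "e / (\<bar>C\<bar> + 1) > 0" using e by simp
    fix y assume y: "y \<in> S" "norm (y - x) < e / (\<bar>C\<bar> + 1)"
    have "C * norm (y - x) \<le> (\<bar>C\<bar> + 1) * norm (y - x)" by (intro mult_right_mono) auto
    also have "\<dots> \<le> e" using y(2) by (simp add: field_simps)
    finally have "C * norm (y - x) * norm (y - x) \<le> e * norm (y - x)" by (intro mult_right_mono) auto
    then show "norm (F y - F x - g \<bullet> (y - x)) \<le> e * norm (y - x)"
      using assms[OF y(1)] by (simp add: power2_eq_square mult.assoc)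
  qed
qed

text \<open>The mean value theorem, applied to \<open>\<phi>\<close> minus the antiderivative of the
  bound, replaces integration of \<open>\<phi>'\<close>.\<close>

lemma segment_increment_bound:
  fixes \<phi> \<phi>' :: "real \<Rightarrow> real"
  assumes der: "\<And>s. s \<in> {0..1} \<Longrightarrow> (\<phi> has_real_derivative \<phi>' s) (at s within {0..1})"
    and le: "\<And>s. s \<in> {0..1} \<Longrightarrow> \<phi>' s \<le> a + K * s"
  shows "\<phi> 1 - \<phi> 0 \<le> a + K / 2"
proof -
  define \<psi> where "\<psi> s = \<phi> s - a * s - K / 2 * s\<^sup>2" for s
  have d: "(\<psi> has_derivative (\<lambda>h. (\<phi>' s - a - K * s) * h)) (at s within {0..1})"
    if "0 \<le> s" "s \<le> 1" for s
    unfolding \<psi>_def has_field_derivative_def[symmetric]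
    using that by (auto intro!: derivative_eq_intros der)
  obtain s where "s \<in> {0<..<1}" "\<psi> 1 - \<psi> 0 = (\<phi>' s - a - K * s) * (1 - 0)"
    using mvt_simple[of 0 1 \<psi>, OF _ d] by auto
  with le[of s] show ?thesis by (simp add: \<psi>_def)
qed

text \<open>At parameter \<open>s\<close> of the segment the gradient has changed by at most
  \<open>K * s\<close> times the length, which accumulates to the factor \<open>K / 2\<close>. The
  two signs of the absolute value come from \<open>F\<close> and \<open>- F\<close>.\<close>

lemma lipschitz_gradient_imp_quadratic_bound:
  fixes F :: "'a::real_inner \<Rightarrow> real"
  assumes S: "convex S" "x \<in> S" "y \<in> S"
    and grad: "\<And>z. z \<in> S \<Longrightarrow> has_gradient_within F (g z) S z"
    and lip: "\<And>z. z \<in> S \<Longrightarrow> norm (g z - g x) \<le> K * norm (z - x)"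
  shows "\<bar>F y - F x - g x \<bullet> (y - x)\<bar> \<le> K / 2 * (norm (y - x))\<^sup>2"
proof -
  define p where "p s = x + s *\<^sub>R (y - x)" for s
  have p: "p s \<in> S" if "s \<in> {0..1}" for s
  proof -
    have "p s = (1 - s) *\<^sub>R x + s *\<^sub>R y" by (simp add: p_def algebra_simps)
    then show ?thesis using S that by (simp add: convex_alt)
  qed
  have der: "((\<lambda>s. F (p s)) has_real_derivative g (p s) \<bullet> (y - x)) (at s within {0..1})"
    if "s \<in> {0..1}" for s
    unfolding p_def
    by (rule has_real_derivative_along_segment[OF S that]) (use grad[OF p[OF that]] in \<open>simp add: p_def\<close>)
  have bd: "\<bar>g (p s) \<bullet> (y - x) - g x \<bullet> (y - x)\<bar> \<le> K * (norm (y - x))\<^sup>2 * s" if "s \<in> {0..1}" for s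
  proof -
    have "\<bar>(g (p s) - g x) \<bullet> (y - x)\<bar> \<le> norm (g (p s) - g x) * norm (y - x)"
      by (rule Cauchy_Schwarz_ineq2)
    also have "\<dots> \<le> K * norm (p s - x) * norm (y - x)"
      by (intro mult_right_mono lip p that) auto
    finally show ?thesis using that by (simp add: p_def power2_eq_square inner_diff_left mult_ac)
  qed
  have "F (p 1) - F (p 0) \<le> g x \<bullet> (y - x) + K * (norm (y - x))\<^sup>2 / 2"
    by (rule segment_increment_bound[OF der]) (use bd in \<open>force simp: abs_le_iff\<close>)+
  moreover have "- F (p 1) - - F (p 0) \<le> - (g x \<bullet> (y - x)) + K * (norm (y - x))\<^sup>2 / 2"
    by (rule segment_increment_bound[OF DERIV_minus[OF der]]) (use bd in \<open>force simp: abs_le_iff\<close>)+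
  ultimately show ?thesis by (simp add: p_def abs_if)
qed

text \<open>Links the partial derivatives in the statement of the theorem with the joint gradient
  used by the descent argument: a quadratic bound on the product is restricted to the two slices
  through the point.\<close>

lemma partial_gradientsI_quadratic:
  fixes F :: "'t::real_inner \<times> real \<Rightarrow> real"
  assumes A: "convex A" "interior A \<noteq> {}" "\<theta> \<in> A" and I: "open I" "\<gamma> \<in> I"
    and quad: "\<And>w. w \<in> A \<times> I \<Longrightarrow> \<bar>F w - F (\<theta>, \<gamma>) - g \<bullet> (w - (\<theta>, \<gamma>))\<bar> \<le> C * (norm (w - (\<theta>, \<gamma>)))\<^sup>2"
  shows "grad_within (\<lambda>\<theta>. F (\<theta>, \<gamma>)) A \<theta> = fst g" "deriv (\<lambda>\<gamma>. F (\<theta>, \<gamma>)) \<gamma> = snd g"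
proof -
  have "has_gradient_within (\<lambda>\<theta>. F (\<theta>, \<gamma>)) (fst g) A \<theta>"
  proof (rule has_gradient_withinI_quadratic)
    fix \<theta>' assume "\<theta>' \<in> A"
    with quad[of "(\<theta>', \<gamma>)"] I show "\<bar>F (\<theta>', \<gamma>) - F (\<theta>, \<gamma>) - fst g \<bullet> (\<theta>' - \<theta>)\<bar> \<le> C * (norm (\<theta>' - \<theta>))\<^sup>2"
      by (simp add: inner_prod_def norm_Pair)
  qed
  then show "grad_within (\<lambda>\<theta>. F (\<theta>, \<gamma>)) A \<theta> = fst g" by (rule grad_within_eqI[OF A])
  have "has_gradient_within (\<lambda>\<gamma>. F (\<theta>, \<gamma>)) (snd g) I \<gamma>"
  proof (rule has_gradient_withinI_quadratic)
    fix \<gamma>' assume "\<gamma>' \<in> I"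
    with quad[of "(\<theta>, \<gamma>')"] A show "\<bar>F (\<theta>, \<gamma>') - F (\<theta>, \<gamma>) - snd g \<bullet> (\<gamma>' - \<gamma>)\<bar> \<le> C * (norm (\<gamma>' - \<gamma>))\<^sup>2"
      by (simp add: inner_prod_def norm_Pair)
  qed
  then have "((\<lambda>\<gamma>. F (\<theta>, \<gamma>)) has_real_derivative snd g) (at \<gamma>)"
    unfolding has_gradient_within_def has_field_derivative_def at_within_open[OF I(2,1)] inner_real_def .
  then show "deriv (\<lambda>\<gamma>. F (\<theta>, \<gamma>)) \<gamma> = snd g" by (rule DERIV_imp_deriv)
qed

section \<open>Stochastic gradient descent with biased gradients\<close>

lemma borel_measurable_euclidean_componentwise:
  fixes f :: "'x \<Rightarrow> 'e::euclidean_space"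
  assumes "\<And>i. i \<in> Basis \<Longrightarrow> (\<lambda>x. f x \<bullet> i) \<in> borel_measurable M"
  shows "f \<in> borel_measurable M"
proof -
  have "(\<lambda>x. \<Sum>i\<in>Basis. (f x \<bullet> i) *\<^sub>R i) \<in> borel_measurable M" using assms by measurable
  then show ?thesis by (simp add: euclidean_representation)
qed

text \<open>
  Sublevel sets are countable unions, because \<open>g w \<xi>\<close> is the infimum of \<open>g q \<xi> + K * norm (q - w)\<close> over
  a countable dense set of points \<open>q\<close> of \<open>W\<close>.  The set \<open>W\<close> itself need not be Borel.
\<close>

lemma borel_measurable_pair_lipschitz:
  fixes g :: "'e::euclidean_space \<Rightarrow> 'x \<Rightarrow> real"
  assumes meas: "\<And>w. w \<in> W \<Longrightarrow> g w \<in> borel_measurable Q"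
    and lip: "\<And>w w' \<xi>. w \<in> W \<Longrightarrow> w' \<in> W \<Longrightarrow> \<xi> \<in> space Q \<Longrightarrow> \<bar>g w \<xi> - g w' \<xi>\<bar> \<le> K * norm (w - w')"
    and "0 \<le> K"
  shows "(\<lambda>(w, \<xi>). g w \<xi>) \<in> borel_measurable (restrict_space borel W \<Otimes>\<^sub>M Q)"
proof -
  let ?N = "restrict_space borel W \<Otimes>\<^sub>M Q"
  obtain D where D: "countable D" "D \<subseteq> W" "W \<subseteq> closure D" by (rule separable)
  have *: "(case z of (w, \<xi>) \<Rightarrow> g w \<xi>) < a \<longleftrightarrow> (\<exists>q\<in>D. g q (snd z) + K * norm (q - fst z) < a)"
    if z: "z \<in> space ?N" for z a
  proof -
    obtain w \<xi> where zw: "z = (w, \<xi>)" "w \<in> W" "\<xi> \<in> space Q"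
      using z by (auto simp: space_pair_measure space_restrict_space)
    have "\<exists>q\<in>D. g q \<xi> + K * norm (q - w) < a" if "g w \<xi> < a"
    proof -
      \<comment> \<open>Replacing \<open>w\<close> by \<open>q\<close> costs
        \<open>K * norm (q - w)\<close> twice, once in \<open>g\<close> and once in the penalty; the
        added 1 keeps the denominator positive when \<open>K = 0\<close>.\<close>
      define e where "e = (a - g w \<xi>) / (2 * K + 1)"
      have e: "e > 0" using that \<open>0 \<le> K\<close> by (simp add: e_def)
      obtain q where q: "q \<in> D" "norm (q - w) < e"
        using D(3) zw(2) e by (metis closure_approachable dist_norm subsetD)
      have "g q \<xi> \<le> g w \<xi> + K * norm (q - w)" using lip[of q w \<xi>] q D zw by auto
      moreover have "(2 * K + 1) * norm (q - w) < a - g w \<xi>"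
        using q(2) \<open>0 \<le> K\<close> by (simp add: e_def pos_less_divide_eq mult.commute)
      ultimately have "g q \<xi> + K * norm (q - w) < a"
        using norm_ge_zero[of "q - w"] mult_nonneg_nonneg[OF \<open>0 \<le> K\<close> norm_ge_zero[of "q - w"]]
        unfolding ring_distribs mult.assoc by linarith
      then show ?thesis using q(1) by blast
    qed
    moreover have "g w \<xi> < a" if "q \<in> D" "g q \<xi> + K * norm (q - w) < a" for q
      using lip[of q w \<xi>] that D zw by (auto simp: abs_le_iff)
    ultimately show ?thesis using zw by auto
  qed
  have "{z \<in> space ?N. (\<exists>q\<in>D. g q (snd z) + K * norm (q - fst z) < a)} \<in> sets ?N" for a
  proof -
    have [measurable]: "g q \<in> borel_measurable Q" if "q \<in> D" for q using meas that D by auto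
    have [measurable]: "(\<lambda>z. z) \<in> restrict_space borel W \<rightarrow>\<^sub>M borel"
      by (rule measurable_restrict_space1) simp
    \<comment> \<open>The identity map, spelled out on the right, carries \<open>fst z\<close> from
      the restricted sigma-algebra to \<open>borel\<close>, where the norm is measurable.\<close>
    have "{z \<in> space ?N. (\<exists>q\<in>D. g q (snd z) + K * norm (q - fst z) < a)}
      = (\<Union>q\<in>D. {z \<in> space ?N. g q (snd z) + K * norm (q - (\<lambda>z. z) (fst z)) < a})" by auto
    also have "\<dots> \<in> sets ?N"
      by (intro sets.countable_UN'' D(1)) measurable
    finally show ?thesis .
  qed
  then show ?thesis
    unfolding borel_measurable_iff_less using * by (auto cong: conj_cong)
qed

section \<open>Averages of uniformly smooth random functions\<close>

text \<open>Only the values \<open>F w\<close> are assumed measurable and bounded. In the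
  application \<open>G\<close> is evaluated at a chosen maximizer, so its measurability and
  boundedness have to be derived from \<open>F\<close> through the quadratic bound.\<close>

locale stochastic_smooth = Q: prob_space Q for Q :: "'x measure" +
  fixes W :: "'e::euclidean_space set" and F :: "'e \<Rightarrow> 'x \<Rightarrow> real" and G :: "'e \<Rightarrow> 'x \<Rightarrow> 'e"
    and K :: real
  assumes convex_W: "convex W" and int_W: "interior W \<noteq> {}" and K_nonneg: "0 \<le> K"
    and F_quadratic: "\<And>w w' \<xi>. w \<in> W \<Longrightarrow> w' \<in> W \<Longrightarrow> \<xi> \<in> space Q \<Longrightarrow>
      \<bar>F w' \<xi> - F w \<xi> - G w \<xi> \<bullet> (w' - w)\<bar> \<le> K / 2 * (norm (w' - w))\<^sup>2"
    and G_lipschitz: "\<And>w w' \<xi>. w \<in> W \<Longrightarrow> w' \<in> W \<Longrightarrow> \<xi> \<in> space Q \<Longrightarrow>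
      norm (G w \<xi> - G w' \<xi>) \<le> K * norm (w - w')"
    and F_measurable: "\<And>w. w \<in> W \<Longrightarrow> F w \<in> borel_measurable Q"
    and F_bounded: "\<And>w. w \<in> W \<Longrightarrow> \<exists>B. \<forall>\<xi>\<in>space Q. \<bar>F w \<xi>\<bar> \<le> B"
begin

definition mean :: "'e \<Rightarrow> real" where "mean w = (\<integral>\<xi>. F w \<xi> \<partial>Q)"
definition mean_grad :: "'e \<Rightarrow> 'e" where "mean_grad w = (\<integral>\<xi>. G w \<xi> \<partial>Q)"

text \<open>A pointwise limit of measurable difference quotients along the segment from
  \<open>w\<close> to \<open>y\<close>; the quadratic bound makes their error O(1/n). Restricting to
  directions \<open>y - w\<close> keeps the evaluation points inside \<open>W\<close>.\<close>

lemma G_direction_measurable: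
  assumes w: "w \<in> W" and y: "y \<in> W"
  shows "(\<lambda>\<xi>. G w \<xi> \<bullet> (y - w)) \<in> borel_measurable Q"
proof -
  define p where "p n = w + (1 / Suc n) *\<^sub>R (y - w)" for n
  have p: "p n \<in> W" for n
  proof -
    have "p n = (1 - 1 / Suc n) *\<^sub>R w + (1 / Suc n) *\<^sub>R y" 
      unfolding p_def scaleR_diff_left scaleR_diff_right by simp
    moreover have "0 \<le> 1 / real (Suc n)" "1 / real (Suc n) \<le> 1" by auto
    ultimately show ?thesis using convex_W w y unfolding convex_alt by metis
  qed
  show ?thesis
  proof (rule borel_measurable_LIMSEQ_real)
    show "(\<lambda>\<xi>. Suc n * (F (p n) \<xi> - F w \<xi>)) \<in> borel_measurable Q" for n
      using F_measurable[OF p] F_measurable[OF w] by measurable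
    fix \<xi> assume \<xi>: "\<xi> \<in> space Q"
    have b: "norm (Suc n * (F (p n) \<xi> - F w \<xi>) - G w \<xi> \<bullet> (y - w)) \<le> (K / 2 * (norm (y - w))\<^sup>2) * (1 / Suc n)" for n
    proof -
      have "\<bar>F (p n) \<xi> - F w \<xi> - (1 / Suc n) * (G w \<xi> \<bullet> (y - w))\<bar> \<le> K / 2 * ((1 / Suc n) * norm (y - w))\<^sup>2"
        using F_quadratic[OF w p[of n] \<xi>] by (simp add: p_def del: of_nat_Suc)
      then have "Suc n * \<bar>F (p n) \<xi> - F w \<xi> - (1 / Suc n) * (G w \<xi> \<bullet> (y - w))\<bar>
          \<le> Suc n * (K / 2 * ((1 / Suc n) * norm (y - w))\<^sup>2)"
        by (intro mult_left_mono) auto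
      moreover have "Suc n * \<bar>F (p n) \<xi> - F w \<xi> - (1 / Suc n) * (G w \<xi> \<bullet> (y - w))\<bar>
         = \<bar>Suc n * (F (p n) \<xi> - F w \<xi>) - G w \<xi> \<bullet> (y - w)\<bar>"
        by (simp add: abs_mult_pos' right_diff_distrib del: of_nat_Suc)
      ultimately show ?thesis by (simp add: power2_eq_square field_simps del: of_nat_Suc)
    qed
    have "(\<lambda>n. (K / 2 * (norm (y - w))\<^sup>2) * (1 / Suc n)) \<longlonglongrightarrow> 0"
      using tendsto_mult[OF tendsto_const LIMSEQ_inverse_real_of_nat, of "K / 2 * (norm (y - w))\<^sup>2"]
      by (simp add: inverse_eq_divide)
    then have "(\<lambda>n. Suc n * (F (p n) \<xi> - F w \<xi>) - G w \<xi> \<bullet> (y - w)) \<longlonglongrightarrow> 0"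
      by (rule Lim_null_comparison[OF always_eventually[OF allI[OF b]]])
    then show "(\<lambda>n. Suc n * (F (p n) \<xi> - F w \<xi>)) \<longlonglongrightarrow> G w \<xi> \<bullet> (y - w)"
      by (subst LIM_zero_iff[symmetric])
  qed
qed

lemma G_direction_bounded:
  assumes w: "w \<in> W" and y: "y \<in> W"
  shows "\<exists>B. \<forall>\<xi>\<in>space Q. \<bar>G w \<xi> \<bullet> (y - w)\<bar> \<le> B"
proof -
  obtain B B' where "\<And>\<xi>. \<xi> \<in> space Q \<Longrightarrow> \<bar>F w \<xi>\<bar> \<le> B" "\<And>\<xi>. \<xi> \<in> space Q \<Longrightarrow> \<bar>F y \<xi>\<bar> \<le> B'"
    using F_bounded[OF w] F_bounded[OF y] by auto
  then have "\<bar>G w \<xi> \<bullet> (y - w)\<bar> \<le> B + B' + K / 2 * (norm (y - w))\<^sup>2" if "\<xi> \<in> space Q" for \<xi>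
    using F_quadratic[OF w y that] that by (smt (verit))
  then show ?thesis by blast
qed

text \<open>With \<open>z\<close> the centre of a ball in \<open>W\<close>, the directions from
  \<open>w\<close> to \<open>z\<close> and to a point shifted along \<open>i\<close> differ by a
  multiple of \<open>i\<close>. Thus directions into \<open>W\<close> determine every coordinate,
  even when \<open>w\<close> lies on the boundary.\<close>

lemma basis_direction:
  assumes "i \<in> Basis"
  shows "\<exists>y\<in>W. \<exists>z\<in>W. \<exists>r. \<forall>v. v \<bullet> i = r * (v \<bullet> (y - w) - v \<bullet> (z - w))"
proof -
  obtain z e where z: "ball z e \<subseteq> W" "e > 0"
    using int_W by (meson ex_in_conv mem_interior)
  show ?thesis
  proof (rule bexI[of _ "z + (e / 2) *\<^sub>R i"], rule bexI[of _ z], intro exI[of _ "2 / e"] allI)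
    show "z + (e / 2) *\<^sub>R i \<in> W" using z assms by (intro subsetD[OF z(1)]) (simp add: dist_norm)
    show "z \<in> W" using z by auto
    show "v \<bullet> i = 2 / e * (v \<bullet> (z + (e / 2) *\<^sub>R i - w) - v \<bullet> (z - w))" for v
      using z(2) by (simp add: inner_diff_right inner_add_right)
  qed
qed

lemma G_measurable:
  assumes w: "w \<in> W"
  shows "G w \<in> borel_measurable Q"
proof (rule borel_measurable_euclidean_componentwise)
  fix i :: 'e assume "i \<in> Basis"
  then obtain y z r where yz: "y \<in> W" "z \<in> W" "\<And>v. v \<bullet> i = r * (v \<bullet> (y - w) - v \<bullet> (z - w))"
    using basis_direction by meson
  show "(\<lambda>\<xi>. G w \<xi> \<bullet> i) \<in> borel_measurable Q"
    unfolding yz(3)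
    using G_direction_measurable[OF w yz(1)] G_direction_measurable[OF w yz(2)] by measurable
qed

lemma G_bounded:
  assumes w: "w \<in> W"
  obtains B where "\<And>\<xi>. \<xi> \<in> space Q \<Longrightarrow> norm (G w \<xi>) \<le> B"
proof -
  have "\<exists>B. \<forall>\<xi>\<in>space Q. \<bar>G w \<xi> \<bullet> i\<bar> \<le> B" if "i \<in> Basis" for i
  proof -
    obtain y z r where yz: "y \<in> W" "z \<in> W" "\<And>v. v \<bullet> i = r * (v \<bullet> (y - w) - v \<bullet> (z - w))"
      using \<open>i \<in> Basis\<close> basis_direction by meson
    obtain B1 B2 where B: "\<And>\<xi>. \<xi> \<in> space Q \<Longrightarrow> \<bar>G w \<xi> \<bullet> (y - w)\<bar> \<le> B1"
        "\<And>\<xi>. \<xi> \<in> space Q \<Longrightarrow> \<bar>G w \<xi> \<bullet> (z - w)\<bar> \<le> B2"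
      using G_direction_bounded[OF w yz(1)] G_direction_bounded[OF w yz(2)] by metis
    have "\<bar>G w \<xi> \<bullet> i\<bar> \<le> \<bar>r\<bar> * (B1 + B2)" if "\<xi> \<in> space Q" for \<xi>
      unfolding yz(3) abs_mult using B[OF that] by (intro mult_left_mono) auto
    then show ?thesis by blast
  qed
  then obtain B where B: "\<And>i \<xi>. i \<in> Basis \<Longrightarrow> \<xi> \<in> space Q \<Longrightarrow> \<bar>G w \<xi> \<bullet> i\<bar> \<le> B i" by metis
  have "norm (G w \<xi>) \<le> (\<Sum>i\<in>Basis. B i)" if "\<xi> \<in> space Q" for \<xi>
    using norm_le_l1[of "G w \<xi>"] sum_mono[OF B[OF _ that]] by (rule order_trans)
  then show thesis by (rule that)
qed

lemma F_integrable: "w \<in> W \<Longrightarrow> integrable Q (F w)"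
proof -
  assume w: "w \<in> W"
  obtain B where "\<forall>\<xi>\<in>space Q. \<bar>F w \<xi>\<bar> \<le> B" using F_bounded[OF w] ..
  then show ?thesis by (intro Q.integrable_const_bound[of _ B] F_measurable w) simp
qed

lemma G_integrable: 
  assumes w: "w \<in> W" shows "integrable Q (G w)"
proof -
  obtain B where "\<And>\<xi>. \<xi> \<in> space Q \<Longrightarrow> norm (G w \<xi>) \<le> B" using G_bounded[OF w] by metis
  then show ?thesis by (intro Q.integrable_const_bound[of _ B] G_measurable w) auto
qed

lemma mean_quadratic:
  assumes w: "w \<in> W" and w': "w' \<in> W"
  shows "\<bar>mean w' - mean w - mean_grad w \<bullet> (w' - w)\<bar> \<le> K / 2 * (norm (w' - w))\<^sup>2"
proof -
  note [simp] = F_integrable[OF w] F_integrable[OF w'] G_integrable[OF w]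
  have "mean w' - mean w - mean_grad w \<bullet> (w' - w) = (\<integral>\<xi>. F w' \<xi> - F w \<xi> - G w \<xi> \<bullet> (w' - w) \<partial>Q)"
    by (simp add: mean_def mean_grad_def)
  also have "\<bar>\<dots>\<bar> \<le> (\<integral>\<xi>. \<bar>F w' \<xi> - F w \<xi> - G w \<xi> \<bullet> (w' - w)\<bar> \<partial>Q)"
    by (rule integral_abs_bound)
  also have "\<dots> \<le> K / 2 * (norm (w' - w))\<^sup>2"
    using F_quadratic[OF w w'] by (intro Q.integral_le_const) auto
  finally show ?thesis .
qed

lemma mean_grad_lipschitz:
  assumes w: "w \<in> W" and w': "w' \<in> W"
  shows "norm (mean_grad w - mean_grad w') \<le> K * norm (w - w')"
proof -
  note [simp] = G_integrable[OF w] G_integrable[OF w']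
  have "mean_grad w - mean_grad w' = (\<integral>\<xi>. G w \<xi> - G w' \<xi> \<partial>Q)"
    by (simp add: mean_grad_def)
  also have "norm \<dots> \<le> (\<integral>\<xi>. norm (G w \<xi> - G w' \<xi>) \<partial>Q)"
    by (rule integral_norm_bound)
  also have "\<dots> \<le> K * norm (w - w')"
    using G_lipschitz[OF w w'] by (intro Q.integral_le_const) auto
  finally show ?thesis .
qed

lemma mean_has_gradient: "w \<in> W \<Longrightarrow> has_gradient_within mean (mean_grad w) W w"
  using mean_quadratic by (intro has_gradient_withinI_quadratic)

lemma continuous_mean_grad: "continuous_on W mean_grad"
proof -
  have "K-lipschitz_on W mean_grad"
    using mean_grad_lipschitz K_nonneg by (intro lipschitz_onI) (auto simp: dist_norm)
  then show ?thesis by (rule lipschitz_on_continuous_on)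
qed

lemma continuous_mean: "continuous_on W mean"
  using mean_has_gradient unfolding has_gradient_within_def
  by (intro has_derivative_continuous_on) blast

text \<open>Measurability for fixed \<open>w\<close> is not enough along a run, where
  \<open>G\<close> is evaluated at a random iterate and a random sample simultaneously.\<close>

lemma G_pair_measurable:
  "(\<lambda>(w, \<xi>). G w \<xi>) \<in> borel_measurable (restrict_space borel W \<Otimes>\<^sub>M Q)"
proof (rule borel_measurable_euclidean_componentwise)
  fix i :: 'e assume i: "i \<in> Basis"
  have "(\<lambda>(w, \<xi>). G w \<xi> \<bullet> i) \<in> borel_measurable (restrict_space borel W \<Otimes>\<^sub>M Q)"
  proof (rule borel_measurable_pair_lipschitz[OF _ _ K_nonneg])
    show "(\<lambda>\<xi>. G w \<xi> \<bullet> i) \<in> borel_measurable Q" if "w \<in> W" for w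
      using G_measurable[OF that] by measurable
    show "\<bar>G w \<xi> \<bullet> i - G w' \<xi> \<bullet> i\<bar> \<le> K * norm (w - w')"
      if "w \<in> W" "w' \<in> W" "\<xi> \<in> space Q" for w w' \<xi>
      using order_trans[OF Basis_le_norm[OF i] G_lipschitz[OF that]] by (simp add: inner_diff_left)
  qed
  then show "(\<lambda>z. (case z of (w, \<xi>) \<Rightarrow> G w \<xi>) \<bullet> i) \<in> borel_measurable (restrict_space borel W \<Otimes>\<^sub>M Q)"
    by (simp add: case_prod_beta)
qed

end

section \<open>Integrals over a fresh sample independent of the iterate\<close>

lemma (in prob_space) indep_set_mono:
  assumes "indep_set A B" "A' \<subseteq> A" "B' \<subseteq> B"
  shows "indep_set A' B'"
  using assms unfolding indep_sets2_eq by blast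

text \<open>Serves with \<open>fst\<close> and \<open>snd\<close> for \<open>p\<close>: splitting
  the variance of the joint gradient into its \<theta> and \<gamma> parts needs each part to be
  integrable.\<close>

lemma (in stochastic_smooth) squared_deviation_integrable:
  fixes p :: "'e \<Rightarrow> 'f::euclidean_space"
  assumes w: "w \<in> W" and "bounded_linear p"
  shows "integrable Q (\<lambda>\<xi>. (norm (p (mean_grad w) - p (G w \<xi>)))\<^sup>2)"
proof -
  interpret p: bounded_linear p by fact
  obtain B where B: "\<And>\<xi>. \<xi> \<in> space Q \<Longrightarrow> norm (G w \<xi>) \<le> B" using G_bounded[OF w] by metis
  obtain C where C: "0 \<le> C" "\<And>x. norm (p x) \<le> norm x * C" using p.nonneg_bounded by blast
  have [measurable]: "(\<lambda>\<xi>. p (G w \<xi>)) \<in> borel_measurable Q"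
    using measurable_compose[OF G_measurable[OF w] borel_measurable_continuous_onI[OF p.continuous_on[OF continuous_on_id]]] .
  have "norm (p (mean_grad w) - p (G w \<xi>)) \<le> (norm (mean_grad w) + B) * C" if "\<xi> \<in> space Q" for \<xi>
    unfolding p.diff[symmetric]
    by (rule order_trans[OF C(2)])
      (use B[OF that] C(1) norm_triangle_ineq4[of "mean_grad w" "G w \<xi>"] in \<open>intro mult_right_mono; linarith\<close>)
  then show ?thesis
    by (intro Q.integrable_const_bound[of _ "((norm (mean_grad w) + B) * C)\<^sup>2"])
      (auto intro!: AE_I2 power_mono)
qed

text \<open>Independence is the product formula on rectangles, and rectangles determine the product
  of sigma-finite measures.\<close>

lemma (in prob_space) distr_pair_indep_set:
  assumes [measurable]: "Y \<in> measurable M N" "X \<in> measurable M Q"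
    and indep: "indep_set (sets (vimage_algebra (space M) Y N)) (sets (vimage_algebra (space M) X Q))"
  shows "distr M N Y \<Otimes>\<^sub>M distr M Q X = distr M (N \<Otimes>\<^sub>M Q) (\<lambda>\<omega>. (Y \<omega>, X \<omega>))"
proof (rule pair_measure_eqI)
  interpret Y: prob_space "distr M N Y" by (rule prob_space_distr) simp
  interpret X: prob_space "distr M Q X" by (rule prob_space_distr) simp
  show "sigma_finite_measure (distr M N Y)" "sigma_finite_measure (distr M Q X)" by unfold_locales
  fix A B assume "A \<in> sets (distr M N Y)" "B \<in> sets (distr M Q X)"
  then have [measurable]: "A \<in> sets N" "B \<in> sets Q" by auto
  have "Y -` A \<inter> space M \<in> sets (vimage_algebra (space M) Y N)"
    "X -` B \<inter> space M \<in> sets (vimage_algebra (space M) X Q)"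
    by (auto intro!: in_vimage_algebra)
  then have "prob ((Y -` A \<inter> space M) \<inter> (X -` B \<inter> space M))
      = prob (Y -` A \<inter> space M) * prob (X -` B \<inter> space M)"
    using indep unfolding indep_sets2_eq by blast
  moreover have "(\<lambda>\<omega>. (Y \<omega>, X \<omega>)) -` (A \<times> B) \<inter> space M
      = (Y -` A \<inter> space M) \<inter> (X -` B \<inter> space M)" by auto
  ultimately show "emeasure (distr M N Y) A * emeasure (distr M Q X) B
      = emeasure (distr M (N \<Otimes>\<^sub>M Q) (\<lambda>\<omega>. (Y \<omega>, X \<omega>))) (A \<times> B)"
    by (simp add: emeasure_distr emeasure_eq_measure ennreal_mult'')
qed simp

text \<open>Fubini on the product law: the value of \<open>Y\<close> may be frozen while integrating
  over \<open>X\<close>. This does the work of conditioning on the past.\<close>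

lemma (in prob_space) integral_indep_pair:
  fixes \<phi> :: "'b \<times> 'c \<Rightarrow> real"
  assumes [measurable]: "Y \<in> measurable M N" "X \<in> measurable M Q"
    and indep: "indep_set (sets (vimage_algebra (space M) Y N)) (sets (vimage_algebra (space M) X Q))"
    and distr: "distr M Q X = Q"
    and \<phi>: "\<phi> \<in> borel_measurable (N \<Otimes>\<^sub>M Q)" and int: "integrable M (\<lambda>\<omega>. \<phi> (Y \<omega>, X \<omega>))"
  shows "(\<integral>\<omega>. \<phi> (Y \<omega>, X \<omega>) \<partial>M) = (\<integral>y. \<integral>x. \<phi> (y, x) \<partial>Q \<partial>distr M N Y)"
    and "integrable (distr M N Y) (\<lambda>y. \<integral>x. \<phi> (y, x) \<partial>Q)"
proof -
  note pair = distr_pair_indep_set[OF assms(1-3), unfolded distr]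
  interpret Y: prob_space "distr M N Y" by (rule prob_space_distr) simp
  interpret X: prob_space Q using prob_space_distr[of X Q] distr by simp
  interpret pair_sigma_finite "distr M N Y" Q ..
  have i: "integrable (distr M N Y \<Otimes>\<^sub>M Q) \<phi>"
    unfolding pair using int \<phi> by (subst integrable_distr_eq) auto
  show "integrable (distr M N Y) (\<lambda>y. \<integral>x. \<phi> (y, x) \<partial>Q)"
    using i by (rule integrable_fst')
  have "(\<integral>\<omega>. \<phi> (Y \<omega>, X \<omega>) \<partial>M) = integral\<^sup>L (distr M N Y \<Otimes>\<^sub>M Q) \<phi>"
    unfolding pair using \<phi> by (subst integral_distr) auto
  also have "\<dots> = (\<integral>y. \<integral>x. \<phi> (y, x) \<partial>Q \<partial>distr M N Y)"
    using i by (rule integral_fst'[symmetric])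
  finally show "(\<integral>\<omega>. \<phi> (Y \<omega>, X \<omega>) \<partial>M) = \<dots>" .
qed

section \<open>The descent inequality for one biased step, and its telescoped sum\<close>

text \<open>The inequality is an identity up to dropped squares: with
  \<open>b = K * a\<^sup>2\<close>, the right side minus the left side equals \<open>(a - b) / 2 *
  (norm (g + e))\<^sup>2 + b / 2 * (norm (n - e))\<^sup>2 + (a + b) / 2 * (\<delta> - (norm
  e)\<^sup>2)\<close>. The condition \<open>a * K \<le> 1\<close> is what gives
  \<open>b \<le> a\<close>.\<close>

lemma biased_step_inequality:
  fixes g n e :: "'e::real_inner"
  assumes "0 \<le> K" "0 < a" "a * K \<le> 1" "(norm e)\<^sup>2 \<le> \<delta>"
  shows "- a * (g \<bullet> (g + n + e)) + K / 2 * (norm (a *\<^sub>R (g + n + e)))\<^sup>2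
    \<le> a / 2 * (\<delta> - (norm g)\<^sup>2) + (K * a\<^sup>2 - a) * (g \<bullet> n) + K * a\<^sup>2 * (norm n)\<^sup>2 + K * a\<^sup>2 / 2 * \<delta>"
proof -
  define b where "b = K * a\<^sup>2"
  have b: "0 \<le> b" "b \<le> a"
    using assms mult_left_mono[of "a * K" 1 a] by (auto simp: b_def power2_eq_square mult_ac)
  have "0 \<le> (a - b) / 2 * (norm (g + e))\<^sup>2 + b / 2 * (norm (n - e))\<^sup>2
      + (a / 2 + b / 2) * (\<delta> - (norm e)\<^sup>2)"
    using b assms by simp
  also have "\<dots> = a / 2 * (\<delta> - (norm g)\<^sup>2) + (b - a) * (g \<bullet> n) + b * (norm n)\<^sup>2 + b / 2 * \<delta>
      - (- a * (g \<bullet> (g + n + e)) + b / 2 * (norm (g + n + e))\<^sup>2)"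
    unfolding power2_norm_eq_inner inner_simps inner_commute[of e g] inner_commute[of n g]
      inner_commute[of e n]
    by (simp add: field_simps)
  finally show ?thesis
    by (simp add: b_def norm_scaleR power_mult_distrib mult.assoc)
qed

context stochastic_smooth
begin

lemma mean_grad_orthogonal_to_noise:
  assumes "w \<in> W"
  shows "(\<integral>\<xi>. mean_grad w \<bullet> (G w \<xi> - mean_grad w) \<partial>Q) = 0"
proof -
  note [simp] = G_integrable[OF assms]
  have "(\<integral>\<xi>. mean_grad w \<bullet> (G w \<xi> - mean_grad w) \<partial>Q) = mean_grad w \<bullet> (\<integral>\<xi>. G w \<xi> - mean_grad w \<partial>Q)"
    by (intro integral_inner_right) simp
  also have "(\<integral>\<xi>. G w \<xi> - mean_grad w \<partial>Q) = 0"
    by (simp add: mean_grad_def Q.prob_space)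
  finally show ?thesis by simp
qed

text \<open>The error of the gradient estimate is bounded through the increment of the iterates,
  which leaves its dependence on \<open>X t\<close> and on the past free. Independence is used only
  between \<open>w t\<close> and \<open>X t\<close>.\<close>

theorem biased_sgd:
  fixes M :: "'w measure" and w :: "nat \<Rightarrow> 'w \<Rightarrow> 'e" and X :: "nat \<Rightarrow> 'w \<Rightarrow> 'x"
  assumes M: "prob_space M"
    and w_measurable: "\<And>t. t \<le> T \<Longrightarrow> w t \<in> borel_measurable M"
    and w_in: "\<And>t \<omega>. t \<le> T \<Longrightarrow> \<omega> \<in> space M \<Longrightarrow> w t \<omega> \<in> W"
    and w_0: "\<And>\<omega>. \<omega> \<in> space M \<Longrightarrow> w 0 \<omega> = w0"
    and X_measurable: "\<And>t. t < T \<Longrightarrow> X t \<in> measurable M Q"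
    and X: "\<And>t. t < T \<Longrightarrow> distr M Q (X t) = Q"
    and indep: "\<And>t. t < T \<Longrightarrow> prob_space.indep_set M
      (sets (vimage_algebra (space M) (w t) (restrict_space borel W)))
      (sets (vimage_algebra (space M) (X t) Q))"
    and step: "\<And>t \<omega>. t < T \<Longrightarrow> \<omega> \<in> space M \<Longrightarrow>
      (norm ((1 / a) *\<^sub>R (w t \<omega> - w (Suc t) \<omega>) - G (w t \<omega>) (X t \<omega>)))\<^sup>2 \<le> \<delta>"
    and variance: "\<And>w. w \<in> W \<Longrightarrow> (\<integral>\<xi>. (norm (mean_grad w - G w \<xi>))\<^sup>2 \<partial>Q) \<le> v"
    and gap: "\<And>w. w \<in> W \<Longrightarrow> mean w0 - mean w \<le> \<Lambda>"
    and a: "0 < a" "a * K \<le> 1"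
  shows "t < T \<Longrightarrow> integrable M (\<lambda>\<omega>. (norm (mean_grad (w t \<omega>)))\<^sup>2)"
    and "(\<Sum>t<T. \<integral>\<omega>. (norm (mean_grad (w t \<omega>)))\<^sup>2 \<partial>M)
      \<le> 2 * \<Lambda> / a + real T * (\<delta> + 2 * K * a * v + K * a * \<delta>)"
proof -
  interpret M: prob_space M by fact
  have w0: "w0 \<in> W" using M.not_empty w_in[of 0] w_0 by auto
  have X_in: "X t \<omega> \<in> space Q" if "t < T" "\<omega> \<in> space M" for t \<omega>
    using X_measurable[OF that(1)] that(2) by (rule measurable_space)
  have w_measurable': "w t \<in> measurable M (restrict_space borel W)" if "t \<le> T" for t
    using w_measurable w_in that by (intro measurable_restrict_space2) auto
  have mean_w_measurable: "(\<lambda>\<omega>. mean (w t \<omega>)) \<in> borel_measurable M" if "t \<le> T" for t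
    by (rule measurable_compose[OF w_measurable'[OF that] borel_measurable_continuous_on_restrict])
      (rule continuous_mean)
  have mg_w_measurable: "(\<lambda>\<omega>. mean_grad (w t \<omega>)) \<in> borel_measurable M" if "t \<le> T" for t
    by (rule measurable_compose[OF w_measurable'[OF that] borel_measurable_continuous_on_restrict])
      (rule continuous_mean_grad)
  have G_w_measurable: "(\<lambda>\<omega>. G (w t \<omega>) (X t \<omega>)) \<in> borel_measurable M" if "t < T" for t
    using measurable_compose[OF measurable_Pair[OF w_measurable' X_measurable] G_pair_measurable] that
    by simp
  obtain B where B: "\<And>\<xi>. \<xi> \<in> space Q \<Longrightarrow> norm (G w0 \<xi>) \<le> B" using G_bounded[OF w0] by metis
  have G_le: "norm (G u \<xi>) \<le> B + K * R" if "u \<in> W" "norm (u - w0) \<le> R" "\<xi> \<in> space Q" for u \<xi> R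
    using norm_triangle_sub[of "G u \<xi>" "G w0 \<xi>"] B[OF that(3)] G_lipschitz[OF that(1) w0 that(3)]
      mult_left_mono[OF that(2) K_nonneg] by simp
  \<comment> \<open>The radius depends on \<open>t\<close> but not on \<open>\<omega>\<close>:
    within distance \<open>R\<close> of \<open>w0\<close> the gradient is at most
    \<open>B + K * R\<close> and its error at most \<open>sqrt \<delta>\<close>. All random
    variables below are therefore bounded, hence integrable.\<close>
  have "\<exists>R. \<forall>\<omega>\<in>space M. norm (w t \<omega> - w0) \<le> R" if "t \<le> T" for t
    using that
  proof (induction t)
    case 0
    then show ?case using w_0 by (intro exI[of _ 0]) simp
  next
    case (Suc t)
    then obtain R where R: "\<And>\<omega>. \<omega> \<in> space M \<Longrightarrow> norm (w t \<omega> - w0) \<le> R" by auto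
    have "norm (w (Suc t) \<omega> - w0) \<le> R + a * (sqrt \<delta> + (B + K * R))" if \<omega>: "\<omega> \<in> space M" for \<omega>
    proof -
      let ?e = "(1 / a) *\<^sub>R (w t \<omega> - w (Suc t) \<omega>) - G (w t \<omega>) (X t \<omega>)"
      have t: "t < T" using Suc by simp
      have "norm ?e \<le> sqrt \<delta>" using step[OF t \<omega>] by (rule real_le_rsqrt)
      moreover have "norm (G (w t \<omega>) (X t \<omega>)) \<le> B + K * R"
        using w_in X_in t \<omega> R by (intro G_le) auto
      ultimately have "norm (?e + G (w t \<omega>) (X t \<omega>)) \<le> sqrt \<delta> + (B + K * R)"
        by (rule norm_triangle_mono)
      then have "norm (a *\<^sub>R (?e + G (w t \<omega>) (X t \<omega>))) \<le> a * (sqrt \<delta> + (B + K * R))"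
        using a by (simp add: pos_divide_le_eq mult.commute)
      moreover have "w (Suc t) \<omega> - w0 = (w t \<omega> - w0) - a *\<^sub>R (?e + G (w t \<omega>) (X t \<omega>))"
        using a by simp
      ultimately show ?thesis using R[OF \<omega>] norm_triangle_ineq4[of "w t \<omega> - w0"] by (smt (verit))
    qed
    then show ?case by blast
  qed
  then obtain R where R: "\<And>t \<omega>. t \<le> T \<Longrightarrow> \<omega> \<in> space M \<Longrightarrow> norm (w t \<omega> - w0) \<le> R t" by metis
  have mg_w_bound: "norm (mean_grad (w t \<omega>)) \<le> norm (mean_grad w0) + K * R t"
    if "t \<le> T" "\<omega> \<in> space M" for t \<omega>
    using norm_triangle_sub[of "mean_grad (w t \<omega>)" "mean_grad w0"]
      mean_grad_lipschitz[OF w_in[OF that] w0] mult_left_mono[OF R[OF that] K_nonneg] by simp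
  have G_w_bound: "norm (G (w t \<omega>) (X t \<omega>)) \<le> B + K * R t" if "t < T" "\<omega> \<in> space M" for t \<omega>
    using w_in X_in R that by (intro G_le) auto
  have mg_integrable: "integrable M (\<lambda>\<omega>. (norm (mean_grad (w t \<omega>)))\<^sup>2)" if "t \<le> T" for t
  proof (rule M.integrable_const_bound)
    show "AE \<omega> in M. norm ((norm (mean_grad (w t \<omega>)))\<^sup>2) \<le> (norm (mean_grad w0) + K * R t)\<^sup>2"
      using mg_w_bound[OF that] by (intro AE_I2) (auto intro: power_mono)
  qed (use mg_w_measurable[OF that] in measurable)
  then show "t < T \<Longrightarrow> integrable M (\<lambda>\<omega>. (norm (mean_grad (w t \<omega>)))\<^sup>2)" by simp
  have mean_integrable: "integrable M (\<lambda>\<omega>. mean (w t \<omega>))" if "t \<le> T" for t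
  proof (rule M.integrable_const_bound)
    have "\<bar>mean (w t \<omega>)\<bar> \<le> \<bar>mean w0\<bar> + norm (mean_grad w0) * R t + K / 2 * (R t)\<^sup>2"
      if "\<omega> \<in> space M" for \<omega>
    proof -
      have "\<bar>mean_grad w0 \<bullet> (w t \<omega> - w0)\<bar> \<le> norm (mean_grad w0) * R t"
        using Cauchy_Schwarz_ineq2[of "mean_grad w0" "w t \<omega> - w0"]
          mult_left_mono[OF R[OF \<open>t \<le> T\<close> that], of "norm (mean_grad w0)"] by simp
      moreover have "K / 2 * (norm (w t \<omega> - w0))\<^sup>2 \<le> K / 2 * (R t)\<^sup>2"
        using R[OF \<open>t \<le> T\<close> that] K_nonneg by (intro mult_left_mono power_mono) auto
      ultimately show ?thesis using mean_quadratic[OF w0 w_in[OF \<open>t \<le> T\<close> that]] by linarith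
    qed
    then show "AE \<omega> in M. norm (mean (w t \<omega>)) \<le> \<bar>mean w0\<bar> + norm (mean_grad w0) * R t + K / 2 * (R t)\<^sup>2"
      by (intro AE_I2) simp
  qed (rule mean_w_measurable[OF that])
  have one_step: "a / 2 * (\<integral>\<omega>. (norm (mean_grad (w t \<omega>)))\<^sup>2 \<partial>M)
      \<le> (\<integral>\<omega>. mean (w t \<omega>) \<partial>M) - (\<integral>\<omega>. mean (w (Suc t) \<omega>) \<partial>M)
        + (a / 2 * \<delta> + K * a\<^sup>2 * v + K * a\<^sup>2 / 2 * \<delta>)" if t: "t < T" for t
  proof -
    have t': "t \<le> T" "Suc t \<le> T" using t by auto
    define n where "n \<omega> = G (w t \<omega>) (X t \<omega>) - mean_grad (w t \<omega>)" for \<omega>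
    have [measurable]: "n \<in> borel_measurable M" "(\<lambda>\<omega>. mean_grad (w t \<omega>)) \<in> borel_measurable M"
      unfolding n_def using G_w_measurable[OF t] mg_w_measurable[OF t'(1)] by measurable
    define C where "C = norm (mean_grad w0) + K * R t"
    have C: "norm (mean_grad (w t \<omega>)) \<le> C" if "\<omega> \<in> space M" for \<omega>
      using mg_w_bound[OF t'(1) that] by (simp add: C_def)
    have n_bound: "norm (n \<omega>) \<le> B + K * R t + C" if "\<omega> \<in> space M" for \<omega>
      unfolding n_def using G_w_bound[OF t that] C[OF that] norm_triangle_ineq4 by (smt (verit))
    have n2_int: "integrable M (\<lambda>\<omega>. (norm (n \<omega>))\<^sup>2)"
      by (rule M.integrable_const_bound[of _ "(B + K * R t + C)\<^sup>2"])
        (auto intro!: AE_I2 power_mono n_bound)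
    have gn_int: "integrable M (\<lambda>\<omega>. mean_grad (w t \<omega>) \<bullet> n \<omega>)"
    proof (rule M.integrable_const_bound)
      have "\<bar>mean_grad (w t \<omega>) \<bullet> n \<omega>\<bar> \<le> C * (B + K * R t + C)" if "\<omega> \<in> space M" for \<omega>
        by (rule order_trans[OF Cauchy_Schwarz_ineq2 mult_mono[OF C n_bound]])
          (use that order_trans[OF norm_ge_zero C[OF that]] in auto)
      then show "AE \<omega> in M. norm (mean_grad (w t \<omega>) \<bullet> n \<omega>) \<le> C * (B + K * R t + C)"
        by (intro AE_I2) simp
    qed measurable
    have [measurable]: "mean_grad \<in> borel_measurable (restrict_space borel W)"
      by (rule borel_measurable_continuous_on_restrict) (rule continuous_mean_grad)
    note [measurable] = G_pair_measurable
    interpret D: prob_space "distr M (restrict_space borel W) (w t)"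
      by (rule M.prob_space_distr[OF w_measurable'[OF t'(1)]])
    \<comment> \<open>With the iterate frozen, the noise has mean zero in the fresh sample, so the
      cross term vanishes. The second moment of the noise is treated in the same way below.\<close>
    have "(\<integral>\<omega>. mean_grad (w t \<omega>) \<bullet> n \<omega> \<partial>M)
      = (\<integral>u. \<integral>\<xi>. mean_grad u \<bullet> (G u \<xi> - mean_grad u) \<partial>Q \<partial>distr M (restrict_space borel W) (w t))"
      using M.integral_indep_pair(1)[OF w_measurable'[OF t'(1)] X_measurable[OF t] indep[OF t] X[OF t],
          of "\<lambda>(u, \<xi>). mean_grad u \<bullet> (G u \<xi> - mean_grad u)"] gn_int
      by (simp add: n_def case_prod_beta)
    also have "\<dots> = (\<integral>u. 0 \<partial>distr M (restrict_space borel W) (w t))"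
      by (intro Bochner_Integration.integral_cong) (auto simp: space_restrict_space mean_grad_orthogonal_to_noise)
    finally have gn_0: "(\<integral>\<omega>. mean_grad (w t \<omega>) \<bullet> n \<omega> \<partial>M) = 0" by simp
    have pair: "(\<lambda>(u, \<xi>). (norm (G u \<xi> - mean_grad u))\<^sup>2) \<in> borel_measurable (restrict_space borel W \<Otimes>\<^sub>M Q)"
      "integrable M (\<lambda>\<omega>. (\<lambda>(u, \<xi>). (norm (G u \<xi> - mean_grad u))\<^sup>2) (w t \<omega>, X t \<omega>))"
      using n2_int by (simp_all add: n_def case_prod_beta)
    have "(\<integral>\<omega>. (norm (n \<omega>))\<^sup>2 \<partial>M)
      = (\<integral>u. \<integral>\<xi>. (norm (G u \<xi> - mean_grad u))\<^sup>2 \<partial>Q \<partial>distr M (restrict_space borel W) (w t))"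
      using M.integral_indep_pair(1)[OF w_measurable'[OF t'(1)] X_measurable[OF t] indep[OF t] X[OF t] pair] by (simp add: n_def)
    also have "\<dots> \<le> v"
      using M.integral_indep_pair(2)[OF w_measurable'[OF t'(1)] X_measurable[OF t] indep[OF t] X[OF t] pair] variance
      by (intro D.integral_le_const AE_I2) (auto simp: space_restrict_space norm_minus_commute)
    finally have n2_le: "(\<integral>\<omega>. (norm (n \<omega>))\<^sup>2 \<partial>M) \<le> v" .
    have "mean (w (Suc t) \<omega>) - mean (w t \<omega>) \<le> a / 2 * (\<delta> - (norm (mean_grad (w t \<omega>)))\<^sup>2)
        + (K * a\<^sup>2 - a) * (mean_grad (w t \<omega>) \<bullet> n \<omega>) + K * a\<^sup>2 * (norm (n \<omega>))\<^sup>2 + K * a\<^sup>2 / 2 * \<delta>"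
      if \<omega>: "\<omega> \<in> space M" for \<omega>
    proof -
      \<comment> \<open>This is the bias; the increment becomes \<open>- a\<close> times the sum of
        mean gradient, noise and bias.\<close>
      define e where "e = (1 / a) *\<^sub>R (w t \<omega> - w (Suc t) \<omega>) - G (w t \<omega>) (X t \<omega>)"
      let ?d = "mean_grad (w t \<omega>) + n \<omega> + e"
      have d: "w (Suc t) \<omega> - w t \<omega> = - (a *\<^sub>R ?d)" using a by (simp add: e_def n_def)
      have "mean (w (Suc t) \<omega>) - mean (w t \<omega>)
        \<le> - a * (mean_grad (w t \<omega>) \<bullet> ?d) + K / 2 * (norm (a *\<^sub>R ?d))\<^sup>2"
        using abs_le_D1[OF mean_quadratic[OF w_in[OF t'(1) \<omega>] w_in[OF t'(2) \<omega>]]] unfolding d by simp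
      also note biased_step_inequality[OF K_nonneg a step[OF t \<omega>, folded e_def]]
      finally show ?thesis .
    qed
    then have "(\<integral>\<omega>. mean (w (Suc t) \<omega>) - mean (w t \<omega>) \<partial>M)
      \<le> (\<integral>\<omega>. a / 2 * (\<delta> - (norm (mean_grad (w t \<omega>)))\<^sup>2)
        + (K * a\<^sup>2 - a) * (mean_grad (w t \<omega>) \<bullet> n \<omega>) + K * a\<^sup>2 * (norm (n \<omega>))\<^sup>2 + K * a\<^sup>2 / 2 * \<delta> \<partial>M)"
      using mean_integrable[OF t'(1)] mean_integrable[OF t'(2)] mg_integrable[OF t'(1)] gn_int n2_int
      by (intro integral_mono) auto
    also have "\<dots> = a / 2 * (\<delta> - (\<integral>\<omega>. (norm (mean_grad (w t \<omega>)))\<^sup>2 \<partial>M))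
        + K * a\<^sup>2 * (\<integral>\<omega>. (norm (n \<omega>))\<^sup>2 \<partial>M) + K * a\<^sup>2 / 2 * \<delta>"
      using mg_integrable[OF t'(1)] gn_int n2_int by (simp add: gn_0 M.prob_space)
    also have "\<dots> \<le> a / 2 * (\<delta> - (\<integral>\<omega>. (norm (mean_grad (w t \<omega>)))\<^sup>2 \<partial>M))
        + K * a\<^sup>2 * v + K * a\<^sup>2 / 2 * \<delta>"
      using mult_left_mono[OF n2_le, of "K * a\<^sup>2"] K_nonneg by simp
    finally show ?thesis
      using mean_integrable[OF t'(1)] mean_integrable[OF t'(2)] by (simp add: right_diff_distrib)
  qed
  let ?S = "\<Sum>t<T. \<integral>\<omega>. (norm (mean_grad (w t \<omega>)))\<^sup>2 \<partial>M"
  let ?c = "a / 2 * \<delta> + K * a\<^sup>2 * v + K * a\<^sup>2 / 2 * \<delta>"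
  have "a / 2 * ?S \<le> (\<Sum>t<T. (\<integral>\<omega>. mean (w t \<omega>) \<partial>M) - (\<integral>\<omega>. mean (w (Suc t) \<omega>) \<partial>M) + ?c)"
    unfolding sum_distrib_left by (intro sum_mono one_step) simp
  also have "\<dots> = (\<integral>\<omega>. mean (w 0 \<omega>) \<partial>M) - (\<integral>\<omega>. mean (w T \<omega>) \<partial>M) + real T * ?c"
    using sum_lessThan_telescope'[of "\<lambda>t. \<integral>\<omega>. mean (w t \<omega>) \<partial>M" T] by (simp add: sum.distrib)
  also have "(\<integral>\<omega>. mean (w 0 \<omega>) \<partial>M) - (\<integral>\<omega>. mean (w T \<omega>) \<partial>M) = (\<integral>\<omega>. mean (w 0 \<omega>) - mean (w T \<omega>) \<partial>M)"
    using mean_integrable by simp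
  also have "\<dots> \<le> \<Lambda>"
    using mean_integrable gap w_in w_0 by (intro M.integral_le_const AE_I2) auto
  finally have "?S \<le> 2 / a * (\<Lambda> + real T * ?c)"
    using a by (simp add: field_simps)
  also have "\<dots> = 2 * \<Lambda> / a + real T * (\<delta> + 2 * K * a * v + K * a * \<delta>)"
    using a by (simp add: field_simps power2_eq_square)
  finally show "?S \<le> 2 * \<Lambda> / a + real T * (\<delta> + 2 * K * a * v + K * a * \<delta>)" .
qed

end

section \<open>The rate for the prescribed step size\<close>

text \<open>This \<open>\<alpha>\<close> balances the initial gap against the noise:
  \<open>\<Lambda> / (\<alpha> * real T)\<close> equals \<open>L * s * \<alpha>\<close>, so together
  they give the summand with factor 4. The bias \<open>\<delta>\<close> gives the summand with
  factor 2, and \<open>L * \<alpha> * \<delta>\<close> the term of order 1/T.\<close>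

lemma step_size_arithmetic:
  fixes L s \<Lambda> \<alpha> \<delta> :: real and T :: nat
  assumes pos: "0 < L" "0 < s" "0 < \<Lambda>" "0 < T" and \<alpha>: "\<alpha> = sqrt (\<Lambda> / (L * s * real T))"
    and \<delta>: "\<delta> = 2 / sqrt (real T)"
  shows "1 / real T * (2 * \<Lambda> / \<alpha> + real T * (\<delta> + 2 * L * \<alpha> * s + L * \<alpha> * \<delta>))
    = (4 * sqrt (L * s * \<Lambda>) + 2) * sqrt (1 / real T) + 2 * sqrt (L * \<Lambda> / s) * (1 / real T)"
proof -
  have \<alpha>_pos: "0 < \<alpha>" using pos by (simp add: \<alpha>)
  have "\<alpha>\<^sup>2 = \<Lambda> / (L * s * real T)" using pos by (simp add: \<alpha>)
  then have \<Lambda>: "\<Lambda> = \<alpha>\<^sup>2 * L * s * real T" using pos by (simp add: field_simps)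
  have q: "sqrt (real T) * sqrt (real T) = real T" "sqrt (real T) \<noteq> 0" using pos by simp_all
  have A: "sqrt (L * s * \<Lambda>) = L * s * \<alpha> * sqrt (real T)"
    using pos \<alpha>_pos by (intro real_sqrt_unique) (simp_all add: \<Lambda> power2_eq_square)
  have B: "sqrt (L * \<Lambda> / s) = L * \<alpha> * sqrt (real T)"
    using pos \<alpha>_pos by (intro real_sqrt_unique) (simp_all add: \<Lambda> power2_eq_square)
  have C: "\<Lambda> / (\<alpha> * real T) = L * s * \<alpha>"
    using pos \<alpha>_pos by (simp add: \<Lambda> power2_eq_square)
  have D: "sqrt (real T) * (1 / real T) = sqrt (1 / real T)" "sqrt (real T) * sqrt (1 / real T) = 1"
    "1 / sqrt (real T) = sqrt (1 / real T)"
    using q pos by (simp_all add: real_sqrt_divide field_simps)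
  have "1 / real T * (2 * \<Lambda> / \<alpha> + real T * (\<delta> + 2 * L * \<alpha> * s + L * \<alpha> * \<delta>))
    = 2 * (\<Lambda> / (\<alpha> * real T)) + 2 * (L * s * \<alpha>) + (1 + L * \<alpha>) * \<delta>"
    using pos \<alpha>_pos by (simp add: field_simps)
  also have "\<dots> = 4 * (L * s * \<alpha>) + (1 + L * \<alpha>) * (2 * sqrt (1 / real T))"
    unfolding C \<delta> D(3)[symmetric] by simp
  also have "\<dots> = (4 * sqrt (L * s * \<Lambda>) + 2) * sqrt (1 / real T) + 2 * sqrt (L * \<Lambda> / s) * (1 / real T)"
  proof -
    have "4 * sqrt (L * s * \<Lambda>) * sqrt (1 / real T) = 4 * (L * s * \<alpha>) * (sqrt (real T) * sqrt (1 / real T))"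
      unfolding A by simp
    moreover have "2 * sqrt (L * \<Lambda> / s) * (1 / real T) = 2 * L * \<alpha> * (sqrt (real T) * (1 / real T))"
      unfolding B by simp
    ultimately show ?thesis unfolding D by (simp add: algebra_simps)
  qed
  finally show ?thesis .
qed

section \<open>The inner maximization problem\<close>

text \<open>Provides a point at which the norms of both components are differentiable within
  \<open>S\<close>: each component either differs from that of \<open>\<xi>\<close> or is constant
  on \<open>S\<close>. If one point moves only the second component and another only the first,
  their midpoint moves both.\<close>

lemma exists_point_off_both_components:
  fixes S :: "('a::real_vector \<times> 'b::real_vector) set"
  assumes S: "convex S" "\<xi> \<in> S" "S \<noteq> {\<xi>}"
  obtains w where "w \<in> S" "w \<noteq> \<xi>"
    "fst w \<noteq> fst \<xi> \<or> (\<forall>u\<in>S. fst u = fst \<xi>)" "snd w \<noteq> snd \<xi> \<or> (\<forall>u\<in>S. snd u = snd \<xi>)"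
proof (cases "(\<forall>u\<in>S. fst u = fst \<xi>) \<or> (\<forall>u\<in>S. snd u = snd \<xi>)")
  case True
  obtain w where "w \<in> S" "w \<noteq> \<xi>" using S by auto
  with True show thesis by (intro that[of w]) (auto simp: prod_eq_iff)
next
  case False
  then obtain a b where a: "a \<in> S" "fst a \<noteq> fst \<xi>" and b: "b \<in> S" "snd b \<noteq> snd \<xi>" by auto
  consider "snd a \<noteq> snd \<xi>" | "fst b \<noteq> fst \<xi>" | "snd a = snd \<xi>" "fst b = fst \<xi>" by blast
  then show thesis
  proof cases
    case 3
    define w where "w = (1 - 1 / 2) *\<^sub>R a + (1 / 2 :: real) *\<^sub>R b"
    have "w \<in> S" using convexD_alt[OF S(1) a(1) b(1), of "1 / 2"] by (simp add: w_def)
    moreover have "fst w - fst \<xi> = (1 / 2 :: real) *\<^sub>R (fst a - fst \<xi>)" "snd w - snd \<xi> = (1 / 2 :: real) *\<^sub>R (snd b - snd \<xi>)"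
      using 3 scaleR_half_double[of "fst \<xi>"] scaleR_half_double[of "snd \<xi>"]
      by (simp_all add: w_def scaleR_diff_right scaleR_right_distrib algebra_simps flip: scaleR_left_distrib)
    ultimately show thesis using a b by (intro that[of w]) auto
  qed (use a b that[of a] that[of b] in auto)
qed

text \<open>Away from zero the norm of an inner product space is differentiable; in the other case
  the function vanishes identically on \<open>S\<close>.\<close>

lemma differentiable_norm_within:
  fixes p :: "'a::real_normed_vector \<Rightarrow> 'b::real_inner"
  assumes "bounded_linear p" "w \<in> S" "p w \<noteq> p \<xi> \<or> (\<forall>u\<in>S. p u = p \<xi>)"
  shows "(\<lambda>u. norm (p (u - \<xi>))) differentiable (at w within S)"
proof (cases "p w = p \<xi>")
  case False
  interpret bounded_linear p by fact
  have "p (w - \<xi>) \<noteq> 0" using False by (simp add: diff)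
  moreover have "(\<lambda>u. p (u - \<xi>)) differentiable (at w within S)"
    using bounded_linear.has_derivative[OF assms(1) has_derivative_diff[OF has_derivative_ident has_derivative_const]]
    unfolding differentiable_def by blast
  ultimately show ?thesis
    using differentiable_compose[of norm "\<lambda>u. p (u - \<xi>)" w S] differentiable_norm_at by blast
next
  case True
  interpret bounded_linear p by fact
  have "\<forall>u\<in>S. norm (p (u - \<xi>)) = 0" using True assms by (simp add: diff)
  then show ?thesis
    using has_derivative_transform[of w S "\<lambda>u. norm (p (u - \<xi>))" "\<lambda>_. 0" "\<lambda>_. 0"] assms(2)
    unfolding differentiable_def by fastforce
qed

text \<open>The origin of the formula for \<open>L\<close>: expand both squares and apply 2ab \<le>
  a^2 + b^2 to the mixed term, whose coefficient is \<open>2 * (L1 * L2 + L3 * L4)\<close>.\<close>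

lemma quadratic_form_le_max:
  fixes a b :: real
  assumes "0 \<le> a" "0 \<le> b" "0 \<le> L1 * L2 + L3 * L4"
  shows "(L4 * a + L3 * b)\<^sup>2 + (L2 * a + L1 * b)\<^sup>2
    \<le> max (L1\<^sup>2 + L3\<^sup>2 + L1 * L2 + L3 * L4) (L2\<^sup>2 + L4\<^sup>2 + L1 * L2 + L3 * L4) * (a\<^sup>2 + b\<^sup>2)"
    (is "_ \<le> max ?P ?R * _")
proof -
  have "0 \<le> (L1 * L2 + L3 * L4) * (a - b)\<^sup>2" using assms by simp
  then have "(L4 * a + L3 * b)\<^sup>2 + (L2 * a + L1 * b)\<^sup>2 \<le> ?R * a\<^sup>2 + ?P * b\<^sup>2"
    by (simp add: power2_eq_square algebra_simps)
  also have "\<dots> \<le> max ?P ?R * a\<^sup>2 + max ?P ?R * b\<^sup>2"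
    by (intro add_mono mult_right_mono) auto
  finally show ?thesis by (simp add: distrib_left)
qed

section \<open>The inner problem on the points at finite transport cost\<close>

text \<open>The gradient fields \<open>gt\<close> and \<open>gx\<close>, which Lipschitz smoothness
  only asserts to exist, are fixed here as parameters.\<close>

locale dro_problem =
  fixes \<kappa> :: ereal and \<rho> :: real and \<Theta> :: "'t::euclidean_space set"
    and \<Xi> :: "('a::euclidean_space \<times> 'b::euclidean_space) set"
    and l :: "'t \<Rightarrow> 'a \<times> 'b \<Rightarrow> real"
    and Ltt Ltx Lxt Lxg \<mu> :: real
    and gt :: "'t \<Rightarrow> 'a \<times> 'b \<Rightarrow> 't" and gx :: "'t \<Rightarrow> 'a \<times> 'b \<Rightarrow> 'a \<times> 'b"
  assumes kappa: "0 < \<kappa>"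
    and convex_Theta: "convex \<Theta>" and int_Theta: "interior \<Theta> \<noteq> {}"
    and compact_Xi: "compact \<Xi>"
    and L_nonneg: "0 \<le> Ltt" "0 \<le> Ltx" "0 \<le> Lxt" "0 \<le> Lxg"
    and grad_theta: "\<And>\<theta> \<xi>. \<theta> \<in> \<Theta> \<Longrightarrow> \<xi> \<in> \<Xi> \<Longrightarrow> has_gradient_within (\<lambda>\<theta>. l \<theta> \<xi>) (gt \<theta> \<xi>) \<Theta> \<theta>"
    and grad_xi: "\<And>\<theta> \<xi>. \<theta> \<in> \<Theta> \<Longrightarrow> \<xi> \<in> \<Xi> \<Longrightarrow> has_gradient_within (\<lambda>\<xi>. l \<theta> \<xi>) (gx \<theta> \<xi>) \<Xi> \<xi>"
    and gt_lipschitz_theta: "\<And>\<theta> \<theta>' \<xi>. \<theta> \<in> \<Theta> \<Longrightarrow> \<theta>' \<in> \<Theta> \<Longrightarrow> \<xi> \<in> \<Xi> \<Longrightarrow>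
      norm (gt \<theta> \<xi> - gt \<theta>' \<xi>) \<le> Ltt * norm (\<theta> - \<theta>')"
    and gt_lipschitz_xi': "\<And>\<theta> \<xi> \<xi>'. \<theta> \<in> \<Theta> \<Longrightarrow> \<xi> \<in> \<Xi> \<Longrightarrow> \<xi>' \<in> \<Xi> \<Longrightarrow> xnorm \<kappa> (\<xi> - \<xi>') < \<infinity> \<Longrightarrow>
      ereal (norm (gt \<theta> \<xi> - gt \<theta> \<xi>')) \<le> ereal Ltx * xnorm \<kappa> (\<xi> - \<xi>')"
    and gx_lipschitz_theta: "\<And>\<theta> \<theta>' \<xi>. \<theta> \<in> \<Theta> \<Longrightarrow> \<theta>' \<in> \<Theta> \<Longrightarrow> \<xi> \<in> \<Xi> \<Longrightarrow>
      xnorm_dual \<kappa> (gx \<theta> \<xi> - gx \<theta>' \<xi>) \<le> ereal (Lxt * norm (\<theta> - \<theta>'))"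
    and grad_h_gamma: "grad_h_lipschitz_gamma \<kappa> \<rho> \<Theta> \<Xi> l Lxg"
    and mu: "0 < \<mu>"
    and strongly_concave: "\<And>\<theta> \<gamma> \<xi>. \<theta> \<in> \<Theta> \<Longrightarrow> 0 < \<gamma> \<Longrightarrow> \<xi> \<in> \<Xi> \<Longrightarrow>
         strongly_concave_on \<kappa> \<mu> \<Xi> (\<lambda>\<xi>'. hfun \<kappa> \<rho> l \<theta> \<gamma> \<xi> \<xi>')"
begin

text \<open>
  Since \<^term>\<open>real_of_ereal \<infinity> = 0\<close>, for \<open>\<kappa> = \<infinity>\<close> the function \<open>rnorm\<close> agrees with
  \<open>xnorm \<infinity>\<close> on vectors of finite norm.
\<close>

definition rnorm :: "'a \<times> 'b \<Rightarrow> real" where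
  "rnorm v = norm (fst v) + real_of_ereal \<kappa> * norm (snd v)"

text \<open>For positive \<gamma> this is the effective domain of the inner objective, the same for
  all \<theta> and \<gamma>. On it \<open>rh\<close> is the real-valued form of
  \<open>hfun\<close>.\<close>

definition reach :: "'a \<times> 'b \<Rightarrow> ('a \<times> 'b) set" where
  "reach \<xi> = {u\<in>\<Xi>. \<kappa> = \<infinity> \<longrightarrow> snd u = snd \<xi>}"

definition rh :: "'t \<Rightarrow> real \<Rightarrow> 'a \<times> 'b \<Rightarrow> 'a \<times> 'b \<Rightarrow> real" where
  "rh \<theta> \<gamma> \<xi> u = l \<theta> u - \<gamma> * rnorm (u - \<xi>) + \<gamma> * \<rho>"

lemma kappa_cases: obtains k where "\<kappa> = ereal k" "0 < k" | "\<kappa> = \<infinity>"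
  using kappa by (cases \<kappa>) auto

lemma real_kappa_nonneg: "0 \<le> real_of_ereal \<kappa>"
  using kappa by (simp add: real_of_ereal_pos)

lemma rnorm_nonneg: "0 \<le> rnorm v"
  using real_kappa_nonneg by (simp add: rnorm_def)

lemma rnorm_triangle: "rnorm (u + v) \<le> rnorm u + rnorm v"
  using real_kappa_nonneg mult_left_mono[OF norm_triangle_ineq[of "snd u" "snd v"] real_kappa_nonneg]
    norm_triangle_ineq[of "fst u" "fst v"]
  by (simp add: rnorm_def distrib_left)

lemma rnorm_scaleR: "rnorm (r *\<^sub>R v) = \<bar>r\<bar> * rnorm v"
  by (simp add: rnorm_def distrib_left mult.left_commute)

lemma rnorm_minus_commute: "rnorm (u - v) = rnorm (v - u)"
  by (simp add: rnorm_def norm_minus_commute)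

lemma rnorm_diff: "\<bar>rnorm (u - \<xi>) - rnorm (v - \<xi>)\<bar> \<le> rnorm (u - v)"
  using rnorm_triangle[of "u - v" "v - \<xi>"] rnorm_triangle[of "v - u" "u - \<xi>"] rnorm_minus_commute[of u v]
  by (simp add: abs_le_iff)

lemma continuous_rnorm [continuous_intros]:
  "continuous_on A f \<Longrightarrow> continuous_on A (\<lambda>x. rnorm (f x))"
  unfolding rnorm_def by (intro continuous_intros)

lemma xnorm_eq_rnorm: "(\<kappa> = \<infinity> \<Longrightarrow> snd v = 0) \<Longrightarrow> xnorm \<kappa> v = ereal (rnorm v)"
  unfolding xnorm_def rnorm_def by (cases rule: kappa_cases) auto

lemma tcost_eq_rnorm: "u \<in> reach \<xi> \<Longrightarrow> tcost \<kappa> u \<xi> = ereal (rnorm (u - \<xi>))"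
  unfolding tcost_def reach_def by (rule xnorm_eq_rnorm) simp

lemma tcost_eq_infty: "u \<in> \<Xi> \<Longrightarrow> u \<notin> reach \<xi> \<Longrightarrow> tcost \<kappa> u \<xi> = \<infinity>"
  unfolding tcost_def reach_def xnorm_def by (cases rule: kappa_cases) auto

lemma hfun_eq_rh: "u \<in> reach \<xi> \<Longrightarrow> hfun \<kappa> \<rho> l \<theta> \<gamma> \<xi> u = ereal (rh \<theta> \<gamma> \<xi> u)"
  by (simp add: hfun_def tcost_eq_rnorm rh_def)

lemma hfun_eq_minus_infty: "u \<in> \<Xi> \<Longrightarrow> u \<notin> reach \<xi> \<Longrightarrow> 0 < \<gamma> \<Longrightarrow> hfun \<kappa> \<rho> l \<theta> \<gamma> \<xi> u = -\<infinity>"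
  by (simp add: hfun_def tcost_eq_infty)

lemma effective_domain: "0 < \<gamma> \<Longrightarrow> {u\<in>\<Xi>. hfun \<kappa> \<rho> l \<theta> \<gamma> \<xi> u \<noteq> -\<infinity>} = reach \<xi>"
proof (intro subset_antisym subsetI)
  assume "0 < \<gamma>"
  fix u assume "u \<in> {u\<in>\<Xi>. hfun \<kappa> \<rho> l \<theta> \<gamma> \<xi> u \<noteq> -\<infinity>}"
  then show "u \<in> reach \<xi>" using hfun_eq_minus_infty[OF _ _ \<open>0 < \<gamma>\<close>] by blast
next
  fix u assume "u \<in> reach \<xi>"
  then show "u \<in> {u\<in>\<Xi>. hfun \<kappa> \<rho> l \<theta> \<gamma> \<xi> u \<noteq> -\<infinity>}"
    by (simp add: hfun_eq_rh) (simp add: reach_def)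
qed

lemma reach_subset: "reach \<xi> \<subseteq> \<Xi>"
  by (auto simp: reach_def)

lemma reach_refl: "\<xi> \<in> \<Xi> \<Longrightarrow> \<xi> \<in> reach \<xi>"
  by (simp add: reach_def)

text \<open>Cauchy-Schwarz in each component, weighted by \<kappa>. For \<kappa> = \<infinity> the
  dual norm does not see the second component of \<open>g\<close>, so that of \<open>v\<close> has
  to vanish.\<close>

lemma inner_le_dual:
  assumes "xnorm_dual \<kappa> g \<le> ereal D" "\<kappa> = \<infinity> \<Longrightarrow> snd v = 0"
  shows "\<bar>g \<bullet> v\<bar> \<le> D * rnorm v"
proof -
  have g: "norm (fst g) \<le> D" using assms(1) by (simp add: xnorm_dual_def)
  have "\<bar>g \<bullet> v\<bar> \<le> norm (fst g) * norm (fst v) + norm (snd g) * norm (snd v)"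
    using Cauchy_Schwarz_ineq2[of "fst g" "fst v"] Cauchy_Schwarz_ineq2[of "snd g" "snd v"]
    by (simp add: inner_prod_def)
  also have "norm (fst g) * norm (fst v) \<le> D * norm (fst v)" using g by (intro mult_right_mono) auto
  also have "norm (snd g) * norm (snd v) \<le> D * (real_of_ereal \<kappa> * norm (snd v))"
  proof (cases rule: kappa_cases)
    case (1 k)
    then have "norm (snd g) \<le> D * k"
      using assms(1) by (simp add: xnorm_dual_def field_simps)
    then show ?thesis using 1 mult_right_mono[of "norm (snd g)" "D * k" "norm (snd v)"] by (simp add: mult.assoc)
  qed (use assms(2) in simp)
  finally show ?thesis by (simp add: rnorm_def distrib_left)
qed

lemma Theta_nonempty: obtains \<theta> where "\<theta> \<in> \<Theta>"
  using int_Theta interior_subset by blast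

text \<open>\<open>\<Xi>\<close> itself is not assumed convex; convexity of the effective domain is
  a clause of strong concavity, read off here at \<gamma> = 1.\<close>

lemma convex_reach:
  assumes "\<xi> \<in> \<Xi>" shows "convex (reach \<xi>)"
proof -
  obtain \<theta> where "\<theta> \<in> \<Theta>" by (rule Theta_nonempty)
  from strongly_concave[OF this, of 1 \<xi>] assms show ?thesis
    by (simp add: strongly_concave_on_def effective_domain)
qed

lemma reach_segment:
  assumes "\<xi> \<in> \<Xi>" "u \<in> reach \<xi>" "v \<in> reach \<xi>" "s \<in> {0..1}"
  shows "u + s *\<^sub>R (v - u) \<in> reach \<xi>"
proof -
  have "u + s *\<^sub>R (v - u) = (1 - s) *\<^sub>R u + s *\<^sub>R v" by (simp add: algebra_simps)
  then show ?thesis using convex_reach[OF assms(1)] assms by (simp add: convex_alt)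
qed

lemma reach_diff: "u \<in> reach \<xi> \<Longrightarrow> v \<in> reach \<xi> \<Longrightarrow> \<kappa> = \<infinity> \<Longrightarrow> snd (u - v) = 0"
  unfolding reach_def by simp

lemma rh_strongly_concave:
  assumes "\<theta> \<in> \<Theta>" "0 < \<gamma>" "\<xi> \<in> \<Xi>" "u \<in> reach \<xi>" "v \<in> reach \<xi>" "s \<in> {0..1}"
  shows "(1 - s) * rh \<theta> \<gamma> \<xi> u + s * rh \<theta> \<gamma> \<xi> v + \<mu> / 2 * s * (1 - s) * (rnorm (u - v))\<^sup>2
    \<le> rh \<theta> \<gamma> \<xi> ((1 - s) *\<^sub>R u + s *\<^sub>R v)"
proof -
  have w: "(1 - s) *\<^sub>R u + s *\<^sub>R v \<in> reach \<xi>"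
    using convex_reach[OF assms(3)] assms by (simp add: convex_alt)
  have "xnorm \<kappa> (u - v) = ereal (rnorm (u - v))"
    using assms(4,5) by (intro xnorm_eq_rnorm reach_diff)
  then show ?thesis
    using strongly_concave[OF assms(1-3), unfolded strongly_concave_on_def effective_domain[OF assms(2)],
        THEN conjunct2, THEN bspec, OF assms(4), THEN bspec, OF assms(5), THEN bspec, OF assms(6)]
    by (simp add: hfun_eq_rh assms w)
qed

lemma gt_lipschitz_xi:
  assumes "\<theta> \<in> \<Theta>" "u \<in> reach \<xi>" "v \<in> reach \<xi>"
  shows "norm (gt \<theta> u - gt \<theta> v) \<le> Ltx * rnorm (u - v)"
proof -
  have "xnorm \<kappa> (u - v) = ereal (rnorm (u - v))"
    using assms(2,3) by (intro xnorm_eq_rnorm reach_diff)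
  moreover have "u \<in> \<Xi>" "v \<in> \<Xi>" using assms reach_subset by blast+
  ultimately show ?thesis using gt_lipschitz_xi'[of \<theta> u v] assms(1) by simp
qed

text \<open>The mean value theorem for \<open>l \<theta> - l \<theta>'\<close> along the segment
  from \<open>v\<close> to \<open>u\<close>. The four-term difference is exactly what remains of the
  losses when the growth inequalities of two maximizers are added.\<close>

lemma loss_diff_lipschitz:
  assumes \<theta>: "\<theta> \<in> \<Theta>" "\<theta>' \<in> \<Theta>" and \<xi>: "\<xi> \<in> \<Xi>" and u: "u \<in> reach \<xi>" and v: "v \<in> reach \<xi>"
  shows "(l \<theta> u - l \<theta>' u) - (l \<theta> v - l \<theta>' v) \<le> Lxt * norm (\<theta> - \<theta>') * rnorm (u - v)"
proof -
  define p where "p s = v + s *\<^sub>R (u - v)" for s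
  have p: "p s \<in> reach \<xi>" if "s \<in> {0..1}" for s
    unfolding p_def by (rule reach_segment[OF \<xi> v u that])
  have g: "has_gradient_within (\<lambda>z. l \<theta> z - l \<theta>' z) (gx \<theta> z - gx \<theta>' z) (reach \<xi>) z"
    if "z \<in> reach \<xi>" for z
  proof -
    have "z \<in> \<Xi>" using that reach_subset by blast
    from has_gradient_within_diff[OF grad_xi[OF \<theta>(1) this] grad_xi[OF \<theta>(2) this]] show ?thesis
      unfolding has_gradient_within_def using reach_subset by (rule has_derivative_subset)
  qed
  have "(l \<theta> (p 1) - l \<theta>' (p 1)) - (l \<theta> (p 0) - l \<theta>' (p 0)) \<le> Lxt * norm (\<theta> - \<theta>') * rnorm (u - v) + 0 / 2"
  proof (rule segment_increment_bound)
    fix s :: real assume s: "s \<in> {0..1}"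
    show "((\<lambda>s. l \<theta> (p s) - l \<theta>' (p s)) has_real_derivative (gx \<theta> (p s) - gx \<theta>' (p s)) \<bullet> (u - v))
        (at s within {0..1})"
      using has_real_derivative_along_segment[OF convex_reach[OF \<xi>] v u s, of "\<lambda>z. l \<theta> z - l \<theta>' z"]
        g[OF p[OF s]] unfolding p_def by blast
    show "(gx \<theta> (p s) - gx \<theta>' (p s)) \<bullet> (u - v) \<le> Lxt * norm (\<theta> - \<theta>') * rnorm (u - v) + 0 * s"
      using inner_le_dual[OF gx_lipschitz_theta[OF \<theta>, of "p s"], of "u - v"] p[OF s] reach_subset[of \<xi>]
        reach_diff[OF u v] by (auto simp: abs_le_iff)
  qed
  then show ?thesis by (simp add: p_def)
qed

text \<open>
  Differentiating the transport cost along the ray through \<open>\<xi>\<close> shows that \<open>Lxg\<close> is at least \<open>1\<close>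
  as soon as anything besides \<open>\<xi>\<close> can be reached.
\<close>

lemma Lxg_ge_1:
  assumes \<xi>: "\<xi> \<in> \<Xi>" and ne: "reach \<xi> \<noteq> {\<xi>}"
  shows "1 \<le> Lxg"
proof -
  obtain \<theta> where \<theta>: "\<theta> \<in> \<Theta>" by (rule Theta_nonempty)
  define F where "F \<gamma> u = real_of_ereal (hfun \<kappa> \<rho> l \<theta> \<gamma> \<xi> u)" for \<gamma> u
  have F: "F \<gamma> u = rh \<theta> \<gamma> \<xi> u" if "u \<in> reach \<xi>" for \<gamma> u
    using that by (simp add: F_def hfun_eq_rh)
  have dom: "{u\<in>\<Xi>. tcost \<kappa> u \<xi> < \<infinity>} = reach \<xi>"
  proof (intro subset_antisym subsetI)
    fix u assume "u \<in> {u\<in>\<Xi>. tcost \<kappa> u \<xi> < \<infinity>}"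
    then show "u \<in> reach \<xi>" using tcost_eq_infty[of u \<xi>] by (cases "u \<in> reach \<xi>") simp_all
  next
    fix u assume "u \<in> reach \<xi>"
    then show "u \<in> {u\<in>\<Xi>. tcost \<kappa> u \<xi> < \<infinity>}"
      using tcost_eq_rnorm[of u \<xi>] reach_subset[of \<xi>] by auto
  qed
  \<comment> \<open>The hypothesis on \<open>Lxg\<close> speaks only about points of
    differentiability, so \<open>w\<close> must avoid the kinks of both norms.\<close>
  obtain w where w: "w \<in> reach \<xi>" "w \<noteq> \<xi>"
    "fst w \<noteq> fst \<xi> \<or> (\<forall>u\<in>reach \<xi>. fst u = fst \<xi>)" "snd w \<noteq> snd \<xi> \<or> (\<forall>u\<in>reach \<xi>. snd u = snd \<xi>)"
    using exists_point_off_both_components[OF convex_reach[OF \<xi>] reach_refl[OF \<xi>] ne] by metis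
  have diff: "F \<gamma> differentiable (at w within reach \<xi>)" for \<gamma>
  proof -
    have "(\<lambda>u. l \<theta> u) differentiable (at w within reach \<xi>)"
      using grad_xi[OF \<theta>, of w] w(1) reach_subset[of \<xi>] has_derivative_subset
      unfolding has_gradient_within_def differentiable_def by blast
    moreover have "(\<lambda>u. rnorm (u - \<xi>)) differentiable (at w within reach \<xi>)"
      unfolding rnorm_def using w
      by (intro differentiable_add differentiable_mult differentiable_const differentiable_norm_within
          bounded_linear_fst bounded_linear_snd)
    ultimately have "rh \<theta> \<gamma> \<xi> differentiable (at w within reach \<xi>)"
      unfolding rh_def[abs_def]
      by (intro differentiable_add differentiable_diff differentiable_mult differentiable_const)
    then show ?thesis
      using has_derivative_transform[OF w(1), of "F \<gamma>" "rh \<theta> \<gamma> \<xi>", OF F] unfolding differentiable_def by blast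
  qed
  have "\<exists>g g'. has_gradient_within (F 1) g (reach \<xi>) w \<and> has_gradient_within (F 2) g' (reach \<xi>) w \<and>
      xnorm_dual \<kappa> (g - g') \<le> ereal (Lxg * \<bar>1 - 2\<bar>)"
    using grad_h_gamma[unfolded grad_h_lipschitz_gamma_def Let_def, THEN conjunct2, THEN bspec, OF \<theta>,
        THEN spec[of _ 1], THEN mp, OF zero_less_one, THEN spec[of _ 2], THEN mp, OF zero_less_numeral,
        THEN bspec, OF \<xi>, unfolded dom, THEN bspec, OF w(1)] diff[of 1] diff[of 2]
    unfolding F_def[abs_def] by blast
  then obtain g g' where g: "has_gradient_within (F 1) g (reach \<xi>) w"
    "has_gradient_within (F 2) g' (reach \<xi>) w" "xnorm_dual \<kappa> (g - g') \<le> ereal (Lxg * \<bar>1 - 2\<bar>)"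
    by blast
  \<comment> \<open>The loss cancels, leaving the transport cost minus \<rho>, which is affine on
    the segment towards \<open>\<xi>\<close>. Gradients within \<open>reach \<xi>\<close> need not
    be unique, so only this directional derivative is compared.\<close>
  let ?q = "\<lambda>s. F 1 (w + s *\<^sub>R (\<xi> - w)) - F 2 (w + s *\<^sub>R (\<xi> - w))"
  have "(?q has_real_derivative (g - g') \<bullet> (\<xi> - w)) (at 0 within {0..1})"
    using has_real_derivative_along_segment[OF convex_reach[OF \<xi>] w(1) reach_refl[OF \<xi>], of 0 "\<lambda>u. F 1 u - F 2 u" "g - g'"]
      has_gradient_within_diff[OF g(1,2)] by simp
  moreover have "(?q has_real_derivative - rnorm (w - \<xi>)) (at 0 within {0..1})"
  proof -
    have der: "((\<lambda>s. (1 - s) * rnorm (w - \<xi>) - \<rho>) has_real_derivative - rnorm (w - \<xi>)) (at 0 within {0..1})"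
      by (auto intro!: derivative_eq_intros)
    have eq: "?q s = (1 - s) * rnorm (w - \<xi>) - \<rho>" if s: "s \<in> {0..1}" for s
    proof -
      have "w + s *\<^sub>R (\<xi> - w) - \<xi> = (1 - s) *\<^sub>R (w - \<xi>)" by (simp add: algebra_simps)
      then show ?thesis
        using reach_segment[OF \<xi> w(1) reach_refl[OF \<xi>] s] s by (simp add: F rh_def rnorm_scaleR)
    qed
    show ?thesis
      unfolding has_field_derivative_def
      by (rule has_derivative_transform[OF _ eq der[unfolded has_field_derivative_def]]) simp_all
  qed
  ultimately have "(g - g') \<bullet> (\<xi> - w) = - rnorm (w - \<xi>)" by (rule DERIV_unique_Icc_0)
  then have "rnorm (w - \<xi>) \<le> Lxg * rnorm (w - \<xi>)"
    using inner_le_dual[OF g(3), of "\<xi> - w"] reach_diff[OF reach_refl[OF \<xi>] w(1)]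
      rnorm_minus_commute[of w \<xi>] rnorm_nonneg[of "w - \<xi>"] by simp
  \<comment> \<open>For \<kappa> = \<infinity> the real weight of the second component is 0, but
    then \<open>w \<in> reach \<xi>\<close> forces the first components to differ.\<close>
  moreover have "0 < rnorm (w - \<xi>)"
  proof (cases "fst w = fst \<xi>")
    case True
    then have "snd w \<noteq> snd \<xi>" using w(2) by (simp add: prod_eq_iff)
    then show ?thesis
      using w(1) unfolding rnorm_def reach_def
      by (cases rule: kappa_cases) (auto simp: add_nonneg_pos)
  qed (use real_kappa_nonneg in \<open>simp add: rnorm_def add_pos_nonneg\<close>)
  ultimately show ?thesis by simp
qed

text \<open>If only \<open>\<xi>\<close> is reachable both sides are 0; otherwise the reverse
  triangle inequality is weakened by \<open>1 \<le> Lxg\<close>. This is how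
  \<open>Lxg / \<mu>\<close> enters the stability of the maximizer.\<close>

lemma rnorm_diff_le_Lxg:
  assumes "\<xi> \<in> \<Xi>" "u \<in> reach \<xi>" "v \<in> reach \<xi>"
  shows "\<bar>rnorm (u - \<xi>) - rnorm (v - \<xi>)\<bar> \<le> Lxg * rnorm (u - v)"
proof (cases "reach \<xi> = {\<xi>}")
  case False
  show ?thesis
    using rnorm_diff[of u \<xi> v] mult_right_mono[OF Lxg_ge_1[OF assms(1) False] rnorm_nonneg[of "u - v"]]
    by simp
qed (use assms in \<open>simp add: rnorm_def\<close>)

section \<open>The inner maximizer: existence, quadratic growth, stability\<close>

lemma continuous_loss: "\<theta> \<in> \<Theta> \<Longrightarrow> continuous_on \<Xi> (l \<theta>)"
  using grad_xi unfolding has_gradient_within_def by (intro has_derivative_continuous_on) blast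

lemma continuous_rh:
  assumes "\<theta> \<in> \<Theta>" shows "continuous_on (\<Xi> \<times> \<Xi>) (\<lambda>p. rh \<theta> \<gamma> (fst p) (snd p))"
  unfolding rh_def
  by (intro continuous_intros continuous_on_compose2[OF continuous_loss[OF assms] continuous_on_snd]) auto

text \<open>Prepares the measurability of the optimal value, whose superlevel sets are projections
  of compact subsets of this graph.\<close>

lemma compact_reach_graph: "compact {p\<in>\<Xi> \<times> \<Xi>. snd p \<in> reach (fst p)}"
proof -
  have "{p\<in>\<Xi> \<times> \<Xi>. snd p \<in> reach (fst p)} = (\<Xi> \<times> \<Xi>) \<inter> {p. \<kappa> = \<infinity> \<longrightarrow> snd (snd p) = snd (fst p)}"
    by (auto simp: reach_def)
  moreover have "closed {p :: ('a \<times> 'b) \<times> ('a \<times> 'b). \<kappa> = \<infinity> \<longrightarrow> snd (snd p) = snd (fst p)}"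
    by (intro closed_Collect_imp open_Collect_const closed_Collect_eq continuous_intros)
  ultimately show ?thesis by (simp add: compact_Int_closed compact_Times compact_Xi)
qed

lemma maximizer_exists:
  assumes "\<theta> \<in> \<Theta>" "\<xi> \<in> \<Xi>"
  shows "\<exists>u\<in>reach \<xi>. \<forall>v\<in>reach \<xi>. rh \<theta> \<gamma> \<xi> v \<le> rh \<theta> \<gamma> \<xi> u"
proof (rule continuous_attains_sup)
  have "reach \<xi> = \<Xi> \<inter> {u. \<kappa> = \<infinity> \<longrightarrow> snd u = snd \<xi>}"
    by (auto simp: reach_def)
  moreover have "closed {u :: 'a \<times> 'b. \<kappa> = \<infinity> \<longrightarrow> snd u = snd \<xi>}"
    by (intro closed_Collect_imp open_Collect_const closed_Collect_eq continuous_intros)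
  ultimately show "compact (reach \<xi>)" by (simp add: compact_Int_closed compact_Xi)
  show "reach \<xi> \<noteq> {}" using reach_refl[OF assms(2)] by auto
  show "continuous_on (reach \<xi>) (rh \<theta> \<gamma> \<xi>)"
    using continuous_on_compose2[OF continuous_rh[OF assms(1)], of "reach \<xi>" "\<lambda>u. (\<xi>, u)" \<gamma>] assms(2) reach_subset[of \<xi>]
    by (force intro!: continuous_intros)
qed

definition umax :: "'t \<Rightarrow> real \<Rightarrow> 'a \<times> 'b \<Rightarrow> 'a \<times> 'b" where
  "umax \<theta> \<gamma> \<xi> = (SOME u. u \<in> reach \<xi> \<and> (\<forall>v\<in>reach \<xi>. rh \<theta> \<gamma> \<xi> v \<le> rh \<theta> \<gamma> \<xi> u))"

lemma umax:
  assumes "\<theta> \<in> \<Theta>" "\<xi> \<in> \<Xi>"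
  shows umax_reach: "umax \<theta> \<gamma> \<xi> \<in> reach \<xi>"
    and rh_le_umax: "v \<in> reach \<xi> \<Longrightarrow> rh \<theta> \<gamma> \<xi> v \<le> rh \<theta> \<gamma> \<xi> (umax \<theta> \<gamma> \<xi>)"
  using someI_ex[OF maximizer_exists[OF assms, unfolded Bex_def], of \<gamma>] unfolding umax_def by auto

lemma hstar_eq:
  assumes "\<theta> \<in> \<Theta>" "0 < \<gamma>" "\<xi> \<in> \<Xi>"
  shows "hstar \<kappa> \<rho> \<Xi> l \<theta> \<gamma> \<xi> = ereal (rh \<theta> \<gamma> \<xi> (umax \<theta> \<gamma> \<xi>))"
  unfolding hstar_def
proof (rule SUP_eqI)
  fix u assume "u \<in> \<Xi>"
  then show "hfun \<kappa> \<rho> l \<theta> \<gamma> \<xi> u \<le> ereal (rh \<theta> \<gamma> \<xi> (umax \<theta> \<gamma> \<xi>))"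
    using hfun_eq_rh hfun_eq_minus_infty rh_le_umax assms by (cases "u \<in> reach \<xi>") simp_all
next
  fix y assume "\<And>u. u \<in> \<Xi> \<Longrightarrow> hfun \<kappa> \<rho> l \<theta> \<gamma> \<xi> u \<le> y"
  then show "ereal (rh \<theta> \<gamma> \<xi> (umax \<theta> \<gamma> \<xi>)) \<le> y"
    using hfun_eq_rh umax_reach[OF assms(1,3)] reach_subset by (metis subsetD)
qed

lemma rhstar_eq:
  "\<theta> \<in> \<Theta> \<Longrightarrow> 0 < \<gamma> \<Longrightarrow> \<xi> \<in> \<Xi> \<Longrightarrow> rhstar \<kappa> \<rho> \<Xi> l \<theta> \<gamma> \<xi> = rh \<theta> \<gamma> \<xi> (umax \<theta> \<gamma> \<xi>)"
  by (simp add: rhstar_def hstar_eq)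

text \<open>Strong concavity on the segment from the maximizer to \<open>v\<close>, combined with
  maximality at its intermediate points, is divided by \<open>s\<close>; then \<open>s\<close> tends
  to 0 from the right. No derivative at the maximizer is involved.\<close>

lemma quadratic_growth:
  assumes "\<theta> \<in> \<Theta>" "0 < \<gamma>" "\<xi> \<in> \<Xi>" "v \<in> reach \<xi>"
  shows "\<mu> / 2 * (rnorm (umax \<theta> \<gamma> \<xi> - v))\<^sup>2 \<le> rh \<theta> \<gamma> \<xi> (umax \<theta> \<gamma> \<xi>) - rh \<theta> \<gamma> \<xi> v"
proof -
  let ?u = "umax \<theta> \<gamma> \<xi>"
  let ?c = "\<mu> / 2 * (rnorm (?u - v))\<^sup>2"
  have u: "?u \<in> reach \<xi>" using assms by (intro umax_reach)
  have le: "?c * (1 - s) \<le> rh \<theta> \<gamma> \<xi> ?u - rh \<theta> \<gamma> \<xi> v" if s: "0 < s" "s < 1" for s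
  proof -
    have "(1 - s) * rh \<theta> \<gamma> \<xi> ?u + s * rh \<theta> \<gamma> \<xi> v + \<mu> / 2 * s * (1 - s) * (rnorm (?u - v))\<^sup>2
      \<le> rh \<theta> \<gamma> \<xi> ((1 - s) *\<^sub>R ?u + s *\<^sub>R v)"
      using s by (intro rh_strongly_concave assms u) auto
    also have "\<dots> \<le> rh \<theta> \<gamma> \<xi> ?u"
      using convex_reach[OF assms(3)] u assms(4) s by (intro rh_le_umax assms) (simp add: convex_alt)
    finally have "s * (?c * (1 - s)) \<le> s * (rh \<theta> \<gamma> \<xi> ?u - rh \<theta> \<gamma> \<xi> v)"
      by (simp add: algebra_simps)
    then show ?thesis using s by simp
  qed
  have "((\<lambda>s. ?c * (1 - s)) \<longlongrightarrow> ?c * (1 - 0)) (at_right 0)" by (intro tendsto_intros)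
  moreover have "\<forall>\<^sub>F s in at_right 0. ?c * (1 - s) \<le> rh \<theta> \<gamma> \<xi> ?u - rh \<theta> \<gamma> \<xi> v"
    using eventually_at_right_real[OF zero_less_one] by (rule eventually_mono) (simp only: le greaterThanLessThan_iff)
  ultimately have "?c * (1 - 0) \<le> rh \<theta> \<gamma> \<xi> ?u - rh \<theta> \<gamma> \<xi> v"
    by (rule tendsto_upperbound) simp
  then show ?thesis by simp
qed

text \<open>Adding the growth inequalities at both maximizers cancels the \<rho> terms and bounds
  \<open>\<mu> * (rnorm (u - v))\<^sup>2\<close> by differences that are linear in
  \<open>rnorm (u - v)\<close>; one factor is then divided out.\<close>

lemma umax_lipschitz:
  assumes \<theta>: "\<theta> \<in> \<Theta>" "\<theta>' \<in> \<Theta>" and \<gamma>: "0 < \<gamma>" "0 < \<gamma>'" and \<xi>: "\<xi> \<in> \<Xi>"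
  shows "rnorm (umax \<theta> \<gamma> \<xi> - umax \<theta>' \<gamma>' \<xi>) \<le> Lxt / \<mu> * norm (\<theta> - \<theta>') + Lxg / \<mu> * \<bar>\<gamma> - \<gamma>'\<bar>"
proof -
  define u v where "u = umax \<theta> \<gamma> \<xi>" and "v = umax \<theta>' \<gamma>' \<xi>"
  have uv: "u \<in> reach \<xi>" "v \<in> reach \<xi>" using umax_reach \<theta> \<xi> by (auto simp: u_def v_def)
  have "\<mu> / 2 * (rnorm (u - v))\<^sup>2 \<le> rh \<theta> \<gamma> \<xi> u - rh \<theta> \<gamma> \<xi> v"
    using quadratic_growth[OF \<theta>(1) \<gamma>(1) \<xi> uv(2)] by (simp add: u_def)
  moreover have "\<mu> / 2 * (rnorm (u - v))\<^sup>2 \<le> rh \<theta>' \<gamma>' \<xi> v - rh \<theta>' \<gamma>' \<xi> u"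
    using quadratic_growth[OF \<theta>(2) \<gamma>(2) \<xi> uv(1)] by (simp add: v_def rnorm_minus_commute)
  ultimately have "\<mu> * (rnorm (u - v))\<^sup>2 \<le> ((l \<theta> u - l \<theta>' u) - (l \<theta> v - l \<theta>' v))
      - (\<gamma> - \<gamma>') * (rnorm (u - \<xi>) - rnorm (v - \<xi>))"
    by (simp add: rh_def algebra_simps)
  also have "\<dots> \<le> Lxt * norm (\<theta> - \<theta>') * rnorm (u - v) + \<bar>\<gamma> - \<gamma>'\<bar> * (Lxg * rnorm (u - v))"
  proof -
    have "\<bar>(\<gamma> - \<gamma>') * (rnorm (u - \<xi>) - rnorm (v - \<xi>))\<bar> \<le> \<bar>\<gamma> - \<gamma>'\<bar> * (Lxg * rnorm (u - v))"
      unfolding abs_mult by (intro mult_left_mono rnorm_diff_le_Lxg \<xi> uv) auto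
    with loss_diff_lipschitz[OF \<theta> \<xi> uv] show ?thesis by linarith
  qed
  finally have *: "\<mu> * rnorm (u - v) * rnorm (u - v)
      \<le> (Lxt * norm (\<theta> - \<theta>') + Lxg * \<bar>\<gamma> - \<gamma>'\<bar>) * rnorm (u - v)"
    by (simp add: power2_eq_square algebra_simps)
  have "\<mu> * rnorm (u - v) \<le> Lxt * norm (\<theta> - \<theta>') + Lxg * \<bar>\<gamma> - \<gamma>'\<bar>"
  proof (cases "rnorm (u - v) = 0")
    case True
    then show ?thesis using L_nonneg by simp
  next
    case False
    then have "0 < rnorm (u - v)" using rnorm_nonneg[of "u - v"] by simp
    with * show ?thesis by (simp add: mult_le_cancel_right)
  qed
  then show ?thesis using mu by (simp add: u_def v_def field_simps)
qed

section \<open>Gradient, smoothness and measurability of the optimal value\<close>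

definition hval :: "'t \<times> real \<Rightarrow> 'a \<times> 'b \<Rightarrow> real" where
  "hval w \<xi> = rhstar \<kappa> \<rho> \<Xi> l (fst w) (snd w) \<xi>"

definition hgrad :: "'t \<times> real \<Rightarrow> 'a \<times> 'b \<Rightarrow> 't \<times> real" where
  "hgrad w \<xi> = (gt (fst w) (umax (fst w) (snd w) \<xi>), \<rho> - rnorm (umax (fst w) (snd w) \<xi> - \<xi>))"

definition L1 where "L1 = Lxg / \<mu>"
definition L2 where "L2 = Lxt / \<mu>"
definition L3 where "L3 = Ltx * Lxg / \<mu>"
definition L4 where "L4 = Ltt + Ltx * Lxt / \<mu>"
definition L where
  "L = sqrt (max (L1\<^sup>2 + L3\<^sup>2 + L1 * L2 + L3 * L4) (L2\<^sup>2 + L4\<^sup>2 + L1 * L2 + L3 * L4))"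

lemma Ls_nonneg: "0 \<le> L1" "0 \<le> L2" "0 \<le> L3" "0 \<le> L4" "0 \<le> L"
proof -
  show "0 \<le> L1" "0 \<le> L2" "0 \<le> L3" "0 \<le> L4"
    using L_nonneg mu by (simp_all add: L1_def L2_def L3_def L4_def)
  then show "0 \<le> L" by (simp add: L_def le_max_iff_disj)
qed

text \<open>Each component changes by a linear form in the changes of \<theta> and \<gamma>, with
  coefficients \<open>L4\<close>, \<open>L3\<close> and \<open>L2\<close>, \<open>L1\<close>. The
  \<theta> component combines its direct change with the change through the maximizer; the \<gamma>
  component has only the latter.\<close>

lemma hgrad_lipschitz:
  assumes w: "w \<in> \<Theta> \<times> {0<..}" and w': "w' \<in> \<Theta> \<times> {0<..}" and \<xi>: "\<xi> \<in> \<Xi>"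
  shows "norm (hgrad w \<xi> - hgrad w' \<xi>) \<le> L * norm (w - w')"
proof -
  obtain \<theta> \<gamma> \<theta>' \<gamma>' where ww: "w = (\<theta>, \<gamma>)" "w' = (\<theta>', \<gamma>')" by (cases w, cases w')
  with w w' have dom: "\<theta> \<in> \<Theta>" "\<theta>' \<in> \<Theta>" "0 < \<gamma>" "0 < \<gamma>'" by auto
  define u v where "u = umax \<theta> \<gamma> \<xi>" and "v = umax \<theta>' \<gamma>' \<xi>"
  have uv: "u \<in> reach \<xi>" "v \<in> reach \<xi>" using umax_reach dom \<xi> by (auto simp: u_def v_def)
  let ?a = "norm (\<theta> - \<theta>')" and ?b = "\<bar>\<gamma> - \<gamma>'\<bar>"
  have d: "rnorm (u - v) \<le> L2 * ?a + L1 * ?b"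
    using umax_lipschitz[OF dom \<xi>] by (simp add: u_def v_def L1_def L2_def)
  have "norm (gt \<theta> u - gt \<theta>' v) \<le> norm (gt \<theta> u - gt \<theta> v) + norm (gt \<theta> v - gt \<theta>' v)"
    using norm_triangle_ineq[of "gt \<theta> u - gt \<theta> v" "gt \<theta> v - gt \<theta>' v"] by simp
  also have "\<dots> \<le> Ltx * rnorm (u - v) + Ltt * ?a"
    using uv subsetD[OF reach_subset uv(2)] dom by (intro add_mono gt_lipschitz_xi gt_lipschitz_theta)
  also have "\<dots> \<le> Ltx * (L2 * ?a + L1 * ?b) + Ltt * ?a"
    using d L_nonneg by (intro add_mono mult_left_mono) auto
  also have "\<dots> = L4 * ?a + L3 * ?b"
    by (simp add: L1_def L2_def L3_def L4_def algebra_simps)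
  finally have t: "norm (gt \<theta> u - gt \<theta>' v) \<le> L4 * ?a + L3 * ?b" .
  have g: "\<bar>rnorm (u - \<xi>) - rnorm (v - \<xi>)\<bar> \<le> L2 * ?a + L1 * ?b"
    using rnorm_diff[of u \<xi> v] d by linarith
  have "(norm (hgrad w \<xi> - hgrad w' \<xi>))\<^sup>2
      = (norm (gt \<theta> u - gt \<theta>' v))\<^sup>2 + \<bar>rnorm (u - \<xi>) - rnorm (v - \<xi>)\<bar>\<^sup>2"
    by (simp add: hgrad_def ww u_def v_def norm_Pair power2_commute)
  also have "\<dots> \<le> (L4 * ?a + L3 * ?b)\<^sup>2 + (L2 * ?a + L1 * ?b)\<^sup>2"
    using t g by (intro add_mono power_mono) auto
  also have "\<dots> \<le> max (L1\<^sup>2 + L3\<^sup>2 + L1 * L2 + L3 * L4) (L2\<^sup>2 + L4\<^sup>2 + L1 * L2 + L3 * L4) * (?a\<^sup>2 + ?b\<^sup>2)"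
    using Ls_nonneg by (intro quadratic_form_le_max) auto
  also have "\<dots> = (L * norm (w - w'))\<^sup>2"
    using Ls_nonneg by (simp add: L_def ww norm_Pair power_mult_distrib le_max_iff_disj)
  finally show ?thesis
    by (rule power2_le_imp_le) (simp add: Ls_nonneg)
qed

text \<open>
  Danskin's theorem in quantitative form: \<open>hval w'\<close> and \<open>hval w\<close> are compared by evaluating \<open>rh\<close>
  at the maximizer for \<open>w\<close> (lower bound) and at the one for \<open>w'\<close> (upper bound).
\<close>

lemma hval_sandwich:
  assumes w: "w \<in> \<Theta> \<times> {0<..}" and w': "w' \<in> \<Theta> \<times> {0<..}" and \<xi>: "\<xi> \<in> \<Xi>"
  shows "\<bar>hval w' \<xi> - hval w \<xi> - hgrad w \<xi> \<bullet> (w' - w)\<bar>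
    \<le> ((Ltx + 1) * (L2 + L1) + Ltt / 2) * (norm (w' - w))\<^sup>2"
proof -
  obtain \<theta> \<gamma> \<theta>' \<gamma>' where ww: "w = (\<theta>, \<gamma>)" "w' = (\<theta>', \<gamma>')" by (cases w, cases w')
  with w w' have dom: "\<theta> \<in> \<Theta>" "\<theta>' \<in> \<Theta>" "0 < \<gamma>" "0 < \<gamma>'" by auto
  define u v where "u = umax \<theta> \<gamma> \<xi>" and "v = umax \<theta>' \<gamma>' \<xi>"
  have uv: "u \<in> reach \<xi>" "v \<in> reach \<xi>" using umax_reach dom \<xi> by (auto simp: u_def v_def)
  let ?a = "norm (\<theta>' - \<theta>)" and ?b = "\<bar>\<gamma>' - \<gamma>\<bar>" and ?n = "norm (w' - w)"
  have ab: "?a \<le> ?n" "?b \<le> ?n"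
    using norm_fst_le[of "\<theta>' - \<theta>" "\<gamma>' - \<gamma>"] norm_snd_le[of "\<gamma>' - \<gamma>" "\<theta>' - \<theta>"] by (simp_all add: ww)
  have val: "hval w \<xi> = rh \<theta> \<gamma> \<xi> u" "hval w' \<xi> = rh \<theta>' \<gamma>' \<xi> v"
    using rhstar_eq dom \<xi> by (simp_all add: hval_def ww u_def v_def)
  have grad: "hgrad w \<xi> \<bullet> (w' - w) = gt \<theta> u \<bullet> (\<theta>' - \<theta>) + (\<rho> - rnorm (u - \<xi>)) * (\<gamma>' - \<gamma>)"
    by (simp add: hgrad_def ww u_def inner_prod_def)
  have incr: "\<bar>rh \<theta>' \<gamma>' \<xi> z - rh \<theta> \<gamma> \<xi> z - (gt \<theta> z \<bullet> (\<theta>' - \<theta>) + (\<rho> - rnorm (z - \<xi>)) * (\<gamma>' - \<gamma>))\<bar>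
      \<le> Ltt / 2 * ?n\<^sup>2" if "z \<in> reach \<xi>" for z
  proof -
    have z: "z \<in> \<Xi>" using that reach_subset by blast
    have "\<bar>l \<theta>' z - l \<theta> z - gt \<theta> z \<bullet> (\<theta>' - \<theta>)\<bar> \<le> Ltt / 2 * ?a\<^sup>2"
      using lipschitz_gradient_imp_quadratic_bound[OF convex_Theta dom(1,2), of "\<lambda>\<theta>. l \<theta> z" "\<lambda>\<theta>. gt \<theta> z" Ltt]
        grad_theta[OF _ z] gt_lipschitz_theta[OF _ dom(1) z] by blast
    also have "\<dots> \<le> Ltt / 2 * ?n\<^sup>2" using ab L_nonneg by (intro mult_left_mono power_mono) auto
    finally show ?thesis by (simp add: rh_def algebra_simps)
  qed
  have "rh \<theta>' \<gamma>' \<xi> u \<le> rh \<theta>' \<gamma>' \<xi> v" "rh \<theta> \<gamma> \<xi> v \<le> rh \<theta> \<gamma> \<xi> u"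
    using rh_le_umax dom \<xi> uv by (simp_all add: u_def v_def)
  \<comment> \<open>The upper bound involves the gradient at \<open>v\<close> where the claim has it
    at \<open>u\<close>. The resulting extra term is of second order, because
    \<open>rnorm (u - v)\<close> is already O(\<open>?n\<close>).\<close>
  with abs_le_D2[OF incr[OF uv(1)]] abs_le_D1[OF incr[OF uv(2)]]
  have lower: "- (Ltt / 2 * ?n\<^sup>2) \<le> hval w' \<xi> - hval w \<xi> - hgrad w \<xi> \<bullet> (w' - w)"
    and upper: "hval w' \<xi> - hval w \<xi> - hgrad w \<xi> \<bullet> (w' - w) \<le> Ltt / 2 * ?n\<^sup>2
      + ((gt \<theta> v - gt \<theta> u) \<bullet> (\<theta>' - \<theta>) + (rnorm (u - \<xi>) - rnorm (v - \<xi>)) * (\<gamma>' - \<gamma>))"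
    unfolding val grad by (simp_all add: algebra_simps inner_diff_left)
  have "rnorm (u - v) \<le> L2 * ?a + L1 * ?b"
    using umax_lipschitz[OF dom \<xi>] by (simp add: u_def v_def L1_def L2_def norm_minus_commute abs_minus_commute)
  also have "\<dots> \<le> L2 * ?n + L1 * ?n" using ab Ls_nonneg by (intro add_mono mult_left_mono)
  finally have d: "rnorm (u - v) \<le> (L2 + L1) * ?n" by (simp add: distrib_right)
  have "(gt \<theta> v - gt \<theta> u) \<bullet> (\<theta>' - \<theta>) \<le> norm (gt \<theta> v - gt \<theta> u) * ?a" by (rule norm_cauchy_schwarz)
  also have "\<dots> \<le> (Ltx * rnorm (u - v)) * ?n"
    using gt_lipschitz_xi[OF dom(1) uv(2,1)] ab rnorm_nonneg L_nonneg
    by (intro mult_mono) (auto simp: rnorm_minus_commute)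
  finally have 1: "(gt \<theta> v - gt \<theta> u) \<bullet> (\<theta>' - \<theta>) \<le> (Ltx * rnorm (u - v)) * ?n" .
  have "(rnorm (u - \<xi>) - rnorm (v - \<xi>)) * (\<gamma>' - \<gamma>) \<le> \<bar>rnorm (u - \<xi>) - rnorm (v - \<xi>)\<bar> * ?b"
    by (metis abs_ge_self abs_mult)
  also have "\<dots> \<le> rnorm (u - v) * ?n"
    using rnorm_diff[of u \<xi> v] ab rnorm_nonneg by (intro mult_mono) auto
  finally have "(gt \<theta> v - gt \<theta> u) \<bullet> (\<theta>' - \<theta>) + (rnorm (u - \<xi>) - rnorm (v - \<xi>)) * (\<gamma>' - \<gamma>)
      \<le> (Ltx + 1) * (rnorm (u - v) * ?n)"
    using 1 by (simp add: algebra_simps)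
  also have "\<dots> \<le> (Ltx + 1) * ((L2 + L1) * ?n * ?n)"
    using d L_nonneg by (intro mult_left_mono mult_right_mono) auto
  finally have "(gt \<theta> v - gt \<theta> u) \<bullet> (\<theta>' - \<theta>) + (rnorm (u - \<xi>) - rnorm (v - \<xi>)) * (\<gamma>' - \<gamma>)
      \<le> (Ltx + 1) * (L2 + L1) * ?n\<^sup>2"
    by (simp add: power2_eq_square mult_ac)
  moreover have "0 \<le> (Ltx + 1) * (L2 + L1) * ?n\<^sup>2" using L_nonneg Ls_nonneg by simp
  ultimately show ?thesis using lower upper unfolding distrib_right by (simp add: abs_le_iff)
qed

lemma convex_domain: "convex (\<Theta> \<times> {0::real<..})"
  by (intro convex_Times convex_Theta convex_real_interval)

text \<open>The sandwich serves only to identify \<open>hgrad\<close> as the gradient; the Lipschitz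
  bound for \<open>hgrad\<close> then yields the constant \<open>L / 2\<close>.\<close>

lemma hval_quadratic:
  assumes w: "w \<in> \<Theta> \<times> {0<..}" and w': "w' \<in> \<Theta> \<times> {0<..}" and \<xi>: "\<xi> \<in> \<Xi>"
  shows "\<bar>hval w' \<xi> - hval w \<xi> - hgrad w \<xi> \<bullet> (w' - w)\<bar> \<le> L / 2 * (norm (w' - w))\<^sup>2"
proof (rule lipschitz_gradient_imp_quadratic_bound[OF convex_domain w w'])
  fix z :: "'t \<times> real" assume z: "z \<in> \<Theta> \<times> {0<..}"
  show "has_gradient_within (\<lambda>w. hval w \<xi>) (hgrad z \<xi>) (\<Theta> \<times> {0<..}) z"
    by (rule has_gradient_withinI_quadratic) (rule hval_sandwich[OF z _ \<xi>])
  show "norm (hgrad z \<xi> - hgrad w \<xi>) \<le> L * norm (z - w)"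
    by (rule hgrad_lipschitz[OF z w \<xi>])
qed

text \<open>Since the maximum is attained, the set is the projection of the compact set of pairs in
  the graph of \<open>reach\<close> with \<open>rh\<close> at least \<open>a\<close>. Upper
  semicontinuity suffices for measurability, whereas for \<kappa> = \<infinity> the set
  \<open>reach \<xi>\<close> may jump as \<xi> varies.\<close>

lemma hval_superlevel_closed:
  assumes w: "w \<in> \<Theta> \<times> {0<..}"
  shows "closed {\<xi>\<in>\<Xi>. a \<le> hval w \<xi>}"
proof -
  obtain \<theta> \<gamma> where w_eq: "w = (\<theta>, \<gamma>)" by (cases w)
  with w have dom: "\<theta> \<in> \<Theta>" "0 < \<gamma>" by auto
  let ?K = "{p\<in>\<Xi> \<times> \<Xi>. snd p \<in> reach (fst p)}"
  let ?A = "?K \<inter> (\<lambda>p. rh \<theta> \<gamma> (fst p) (snd p)) -` {a..}"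
  have "continuous_on ?K (\<lambda>p. rh \<theta> \<gamma> (fst p) (snd p))"
    by (rule continuous_on_subset[OF continuous_rh[OF dom(1)]]) auto
  then have "closed ?A"
    by (rule continuous_closed_preimage) (auto intro: compact_imp_closed compact_reach_graph)
  then have "compact (?K \<inter> ?A)" by (intro compact_Int_closed compact_reach_graph)
  then have "compact (fst ` (?K \<inter> ?A))"
    by (intro compact_continuous_image continuous_on_fst continuous_on_id)
  moreover have "fst ` (?K \<inter> ?A) = {\<xi>\<in>\<Xi>. a \<le> hval w \<xi>}"
  proof (intro subset_antisym subsetI)
    fix \<xi> assume "\<xi> \<in> fst ` (?K \<inter> ?A)"
    then obtain u where u: "\<xi> \<in> \<Xi>" "u \<in> reach \<xi>" "a \<le> rh \<theta> \<gamma> \<xi> u" by auto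
    then show "\<xi> \<in> {\<xi>\<in>\<Xi>. a \<le> hval w \<xi>}"
      using rh_le_umax[OF dom(1) u(1,2), of \<gamma>] dom by (simp add: hval_def w_eq rhstar_eq)
  next
    fix \<xi> assume "\<xi> \<in> {\<xi>\<in>\<Xi>. a \<le> hval w \<xi>}"
    then have \<xi>: "\<xi> \<in> \<Xi>" "a \<le> rh \<theta> \<gamma> \<xi> (umax \<theta> \<gamma> \<xi>)"
      using dom by (auto simp: hval_def w_eq rhstar_eq)
    moreover have "umax \<theta> \<gamma> \<xi> \<in> reach \<xi>" using dom \<xi> by (intro umax_reach)
    ultimately show "\<xi> \<in> fst ` (?K \<inter> ?A)"
      using subsetD[OF reach_subset] by (intro image_eqI[of _ _ "(\<xi>, umax \<theta> \<gamma> \<xi>)"]) auto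
  qed
  ultimately show ?thesis by (simp add: compact_imp_closed)
qed

lemma hval_bounded:
  assumes w: "w \<in> \<Theta> \<times> {0<..}"
  shows "\<exists>B. \<forall>\<xi>\<in>\<Xi>. \<bar>hval w \<xi>\<bar> \<le> B"
proof -
  obtain \<theta> \<gamma> where w_eq: "w = (\<theta>, \<gamma>)" by (cases w)
  with w have dom: "\<theta> \<in> \<Theta>" "0 < \<gamma>" by auto
  have "bounded ((\<lambda>p. rh \<theta> \<gamma> (fst p) (snd p)) ` (\<Xi> \<times> \<Xi>))"
    by (intro compact_imp_bounded compact_continuous_image continuous_rh dom compact_Times compact_Xi)
  then obtain B where B: "\<And>\<xi> u. \<xi> \<in> \<Xi> \<Longrightarrow> u \<in> \<Xi> \<Longrightarrow> \<bar>rh \<theta> \<gamma> \<xi> u\<bar> \<le> B"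
    unfolding bounded_iff by (fastforce simp: image_iff)
  have "\<bar>hval w \<xi>\<bar> \<le> B" if "\<xi> \<in> \<Xi>" for \<xi>
    using B[OF that subsetD[OF reach_subset umax_reach[OF dom(1) that]]] dom that
    by (simp add: hval_def w_eq rhstar_eq)
  then show ?thesis by blast
qed

lemma stochastic_smooth_hval:
  assumes Q: "prob_space Q" "sets Q = sets (restrict_space borel \<Xi>)"
  shows "stochastic_smooth Q (\<Theta> \<times> {0<..}) hval hgrad L"
proof -
  interpret prob_space Q by fact
  have space_Q: "space Q = \<Xi>" using sets_eq_imp_space_eq[OF Q(2)] by (simp add: space_restrict_space)
  show ?thesis
  proof
    show "convex (\<Theta> \<times> {0::real<..})" by (rule convex_domain)
    show "interior (\<Theta> \<times> {0::real<..}) \<noteq> {}"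
      using int_Theta by (simp add: interior_Times interior_open)
    show "0 \<le> L" by (rule Ls_nonneg)
  next
    fix w :: "'t \<times> real" assume w: "w \<in> \<Theta> \<times> {0<..}"
    have "{\<xi>\<in>\<Xi>. a \<le> hval w \<xi>} \<in> sets Q" for a
      using hval_superlevel_closed[OF w, of a] unfolding Q(2)
      by (subst sets_restrict_space_iff) (auto intro: borel_closed compact_imp_closed compact_Xi)
    then show "hval w \<in> borel_measurable Q"
      unfolding borel_measurable_iff_ge space_Q by blast
    show "\<exists>B. \<forall>\<xi>\<in>space Q. \<bar>hval w \<xi>\<bar> \<le> B"
      using hval_bounded[OF w] by (simp add: space_Q)
  qed (use hval_quadratic hgrad_lipschitz space_Q in auto)
qed

text \<open>Quadratic growth turns the accuracy in value into a distance to the maximizer. The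
  factor \<open>Ltx\<^sup>2 + 1\<close> collects the Lipschitz constant \<open>Ltx\<close> of the
  \<theta> gradient and the constant 1 of the transport cost.\<close>

lemma hgrad_error:
  assumes \<theta>: "\<theta> \<in> \<Theta>" and \<gamma>: "0 < \<gamma>" and \<xi>: "\<xi> \<in> \<Xi>" and v: "v \<in> \<Xi>"
    and acc: "\<bar>hstar \<kappa> \<rho> \<Xi> l \<theta> \<gamma> \<xi> - hfun \<kappa> \<rho> l \<theta> \<gamma> \<xi> v\<bar> \<le> ereal \<epsilon>"
  shows "(norm ((gt \<theta> v, \<rho> - real_of_ereal (tcost \<kappa> v \<xi>)) - hgrad (\<theta>, \<gamma>) \<xi>))\<^sup>2
    \<le> (Ltx\<^sup>2 + 1) * (2 * \<epsilon> / \<mu>)"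
proof -
  define u where "u = umax \<theta> \<gamma> \<xi>"
  have u: "u \<in> reach \<xi>" using umax_reach[OF \<theta> \<xi>] by (simp add: u_def)
  \<comment> \<open>Outside \<open>reach \<xi>\<close> the objective is -\<infinity> while the
    supremum is finite, so their distance would be \<infinity> and exceed
    \<open>\<epsilon>\<close>.\<close>
  have v: "v \<in> reach \<xi>"
  proof (rule ccontr)
    assume "v \<notin> reach \<xi>"
    then show False using acc hfun_eq_minus_infty[OF v _ \<gamma>] hstar_eq[OF \<theta> \<gamma> \<xi>] by simp
  qed
  let ?r = "rnorm (u - v)"
  have "\<bar>rh \<theta> \<gamma> \<xi> u - rh \<theta> \<gamma> \<xi> v\<bar> \<le> \<epsilon>"
    using acc unfolding hstar_eq[OF \<theta> \<gamma> \<xi>] hfun_eq_rh[OF v] u_def by simp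
  then have "\<mu> / 2 * ?r\<^sup>2 \<le> \<epsilon>"
    using quadratic_growth[OF \<theta> \<gamma> \<xi> v] by (simp add: u_def abs_le_iff)
  then have r: "?r\<^sup>2 \<le> 2 * \<epsilon> / \<mu>" using mu by (simp add: field_simps)
  have "(norm ((gt \<theta> v, \<rho> - real_of_ereal (tcost \<kappa> v \<xi>)) - hgrad (\<theta>, \<gamma>) \<xi>))\<^sup>2
      = (norm (gt \<theta> u - gt \<theta> v))\<^sup>2 + \<bar>rnorm (u - \<xi>) - rnorm (v - \<xi>)\<bar>\<^sup>2"
    by (simp add: hgrad_def norm_Pair tcost_eq_rnorm[OF v] norm_minus_commute[of "gt \<theta> v"] u_def)
  also have "\<dots> \<le> (Ltx * ?r)\<^sup>2 + ?r\<^sup>2"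
    by (intro add_mono power_mono gt_lipschitz_xi[OF \<theta> u v] rnorm_diff) auto
  also have "\<dots> = (Ltx\<^sup>2 + 1) * ?r\<^sup>2" by (simp add: power_mult_distrib distrib_right)
  also have "\<dots> \<le> (Ltx\<^sup>2 + 1) * (2 * \<epsilon> / \<mu>)" using r by (intro mult_left_mono) auto
  finally show ?thesis .
qed

end

section \<open>From the abstract descent bound to the stated rate\<close>

theorem theorem1:
  fixes \<Theta> :: "(real ^ 'k) set"
    and \<Xi> :: "((real ^ 'p) \<times> (real ^ 'm)) set"
    and f :: "real ^ 'k \<Rightarrow> real ^ 'p \<Rightarrow> 'z"
    and c :: "'z \<Rightarrow> real ^ 'm \<Rightarrow> real"
    and Q :: "((real ^ 'p) \<times> (real ^ 'm)) measure"
    and \<kappa> :: ereal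
    and \<rho> Ltt Ltx Lxt Lxx Lxg \<mu> \<sigma>t \<sigma>g \<Lambda> L1 L2 L3 L4 L \<alpha> \<beta> \<epsilon> \<gamma>0 :: real
    and \<theta>0 :: "real ^ 'k"
    and T :: nat
    and M :: "'w measure"
    and X Xh :: "nat \<Rightarrow> 'w \<Rightarrow> (real ^ 'p) \<times> (real ^ 'm)"
    and th :: "nat \<Rightarrow> 'w \<Rightarrow> real ^ 'k"
    and ga :: "nat \<Rightarrow> 'w \<Rightarrow> real"
  defines "l \<equiv> loss f c"
  defines "H \<equiv> Hfun Q \<kappa> \<rho> \<Xi> l"
  assumes kappa: "0 < \<kappa>"
    and rho: "0 < \<rho>"
    and Theta: "convex \<Theta>" "interior \<Theta> \<noteq> {}"
    and Q: "prob_space Q" "sets Q = sets (restrict_space borel \<Xi>)"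
    and hstar_differentiable:
      "\<And>\<xi> \<theta> \<gamma>. \<xi> \<in> \<Xi> \<Longrightarrow> \<theta> \<in> \<Theta> \<Longrightarrow> 0 < \<gamma> \<Longrightarrow>
         (\<lambda>(\<theta>, \<gamma>). rhstar \<kappa> \<rho> \<Xi> l \<theta> \<gamma> \<xi>) differentiable (at (\<theta>, \<gamma>) within \<Theta> \<times> {0<..})"
    and A1: "compact \<Xi>"
    and A2: "lipschitz_smooth \<kappa> \<Theta> \<Xi> l Ltt Ltx Lxt Lxx"
    and Lxg: "grad_h_lipschitz_gamma \<kappa> \<rho> \<Theta> \<Xi> l Lxg"
    and mu: "0 < \<mu>"
    and A3: "\<And>\<theta> \<gamma> \<xi>. \<theta> \<in> \<Theta> \<Longrightarrow> 0 < \<gamma> \<Longrightarrow> \<xi> \<in> \<Xi> \<Longrightarrow>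
         strongly_concave_on \<kappa> \<mu> \<Xi> (\<lambda>\<xi>'. hfun \<kappa> \<rho> l \<theta> \<gamma> \<xi> \<xi>')"
    and A4_theta: "\<And>\<theta> \<gamma>. \<theta> \<in> \<Theta> \<Longrightarrow> 0 < \<gamma> \<Longrightarrow>
         (\<integral>\<xi>. (norm (grad_within (\<lambda>\<theta>. H \<theta> \<gamma>) \<Theta> \<theta>
                     - grad_within (\<lambda>\<theta>. rhstar \<kappa> \<rho> \<Xi> l \<theta> \<gamma> \<xi>) \<Theta> \<theta>))\<^sup>2 \<partial>Q) \<le> \<sigma>t\<^sup>2"
    and A4_gamma: "\<And>\<theta> \<gamma>. \<theta> \<in> \<Theta> \<Longrightarrow> 0 < \<gamma> \<Longrightarrow>
         (\<integral>\<xi>. (norm (deriv (\<lambda>\<gamma>. H \<theta> \<gamma>) \<gamma> - deriv (\<lambda>\<gamma>. rhstar \<kappa> \<rho> \<Xi> l \<theta> \<gamma> \<xi>) \<gamma>))\<^sup>2 \<partial>Q)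
           \<le> \<sigma>g\<^sup>2"
    and Lambda: "0 < \<Lambda>"
    and gap: "ereal (H \<theta>0 \<gamma>0) - (INF (\<theta>, \<gamma>)\<in>\<Theta> \<times> {0<..}. ereal (H \<theta> \<gamma>)) \<le> ereal \<Lambda>"
    and L1: "L1 = Lxg / \<mu>"
    and L2: "L2 = Lxt / \<mu>"
    and L3: "L3 = Ltx * Lxg / \<mu>"
    and L4: "L4 = Ltt + Ltx * Lxt / \<mu>"
    and L: "L = sqrt (max (L1\<^sup>2 + L3\<^sup>2 + L1 * L2 + L3 * L4) (L2\<^sup>2 + L4\<^sup>2 + L1 * L2 + L3 * L4))"
    and T_pos: "0 < T"
    and well_defined: "0 < L" "0 < \<sigma>t\<^sup>2 + \<sigma>g\<^sup>2"
    and alpha: "\<alpha> = sqrt (\<Lambda> / (L * (\<sigma>t\<^sup>2 + \<sigma>g\<^sup>2) * real T))"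
    and beta: "\<beta> = \<alpha>"
    and step_le: "\<alpha> \<le> 1 / L"
    and eps: "\<epsilon> = \<mu> / ((Ltx\<^sup>2 + 1) * sqrt (real T))"
    and run: "da_sgd_run M Q \<kappa> \<rho> \<Theta> \<Xi> l \<alpha> \<beta> \<epsilon> T \<theta>0 \<gamma>0 X Xh th ga"
  shows "(\<forall>t<T. integrable M (\<lambda>\<omega>.
             (norm (grad_within (\<lambda>\<theta>. H \<theta> (ga t \<omega>)) \<Theta> (th t \<omega>)))\<^sup>2
           + (norm (deriv (\<lambda>\<gamma>. H (th t \<omega>) \<gamma>) (ga t \<omega>)))\<^sup>2)) \<and>
         1 / real T * (\<Sum>t<T. \<integral>\<omega>.
             (norm (grad_within (\<lambda>\<theta>. H \<theta> (ga t \<omega>)) \<Theta> (th t \<omega>)))\<^sup>2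
           + (norm (deriv (\<lambda>\<gamma>. H (th t \<omega>) \<gamma>) (ga t \<omega>)))\<^sup>2 \<partial>M)
         \<le> (4 * sqrt (L * (\<sigma>t\<^sup>2 + \<sigma>g\<^sup>2) * \<Lambda>) + 2) * sqrt (1 / real T)
            + 2 * sqrt (L * \<Lambda> / (\<sigma>t\<^sup>2 + \<sigma>g\<^sup>2)) * (1 / real T)"
proof -
  obtain gt gx where g:
    "\<forall>\<theta>\<in>\<Theta>. \<forall>\<xi>\<in>\<Xi>. has_gradient_within (\<lambda>\<theta>. l \<theta> \<xi>) (gt \<theta> \<xi>) \<Theta> \<theta> \<and>
       has_gradient_within (\<lambda>\<xi>. l \<theta> \<xi>) (gx \<theta> \<xi>) \<Xi> \<xi>"
    "\<forall>\<theta>\<in>\<Theta>. \<forall>\<theta>'\<in>\<Theta>. \<forall>\<xi>\<in>\<Xi>. norm (gt \<theta> \<xi> - gt \<theta>' \<xi>) \<le> Ltt * norm (\<theta> - \<theta>')"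
    "\<forall>\<theta>\<in>\<Theta>. \<forall>\<xi>\<in>\<Xi>. \<forall>\<xi>'\<in>\<Xi>. xnorm \<kappa> (\<xi> - \<xi>') < \<infinity> \<longrightarrow>
       ereal (norm (gt \<theta> \<xi> - gt \<theta> \<xi>')) \<le> ereal Ltx * xnorm \<kappa> (\<xi> - \<xi>')"
    "\<forall>\<theta>\<in>\<Theta>. \<forall>\<theta>'\<in>\<Theta>. \<forall>\<xi>\<in>\<Xi>. xnorm_dual \<kappa> (gx \<theta> \<xi> - gx \<theta>' \<xi>) \<le> ereal (Lxt * norm (\<theta> - \<theta>'))"
    using A2 unfolding lipschitz_smooth_def by (elim conjE exE)
  interpret D: dro_problem \<kappa> \<rho> \<Theta> \<Xi> l Ltt Ltx Lxt Lxg \<mu> gt gx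
  proof
    show "0 \<le> Ltt" "0 \<le> Ltx" "0 \<le> Lxt" using A2 by (simp_all add: lipschitz_smooth_def)
    show "0 \<le> Lxg" using Lxg by (simp add: grad_h_lipschitz_gamma_def)
  qed (use kappa Theta A1 g Lxg mu A3 in blast)+
  have L_eq: "L = D.L" by (simp add: L L1 L2 L3 L4 D.L_def D.L1_def D.L2_def D.L3_def D.L4_def)
  let ?W = "\<Theta> \<times> {0<..}"
  interpret S: stochastic_smooth Q ?W D.hval D.hgrad L
    unfolding L_eq using Q by (rule D.stochastic_smooth_hval)
  have space_Q: "space Q = \<Xi>" using sets_eq_imp_space_eq[OF Q(2)] by (simp add: space_restrict_space)
  have H_eq: "H \<theta> \<gamma> = S.mean (\<theta>, \<gamma>)" for \<theta> \<gamma>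
    by (simp add: H_def Hfun_def S.mean_def D.hval_def)
  have H_grad: "grad_within (\<lambda>\<theta>. H \<theta> \<gamma>) \<Theta> \<theta> = fst (S.mean_grad (\<theta>, \<gamma>))"
      "deriv (\<lambda>\<gamma>. H \<theta> \<gamma>) \<gamma> = snd (S.mean_grad (\<theta>, \<gamma>))" if "\<theta> \<in> \<Theta>" "0 < \<gamma>" for \<theta> \<gamma>
    unfolding H_eq using that Theta
    by (intro partial_gradientsI_quadratic[of \<Theta> \<theta> "{0<..}" \<gamma> S.mean _ "L / 2"] S.mean_quadratic; simp)+
  have h_grad: "grad_within (\<lambda>\<theta>. rhstar \<kappa> \<rho> \<Xi> l \<theta> \<gamma> \<xi>) \<Theta> \<theta> = fst (D.hgrad (\<theta>, \<gamma>) \<xi>)"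
      "deriv (\<lambda>\<gamma>. rhstar \<kappa> \<rho> \<Xi> l \<theta> \<gamma> \<xi>) \<gamma> = snd (D.hgrad (\<theta>, \<gamma>) \<xi>)"
    if "\<theta> \<in> \<Theta>" "0 < \<gamma>" "\<xi> \<in> \<Xi>" for \<theta> \<gamma> \<xi>
  proof -
    have r: "rhstar \<kappa> \<rho> \<Xi> l \<theta> \<gamma> \<xi> = (\<lambda>w. D.hval w \<xi>) (\<theta>, \<gamma>)" for \<theta> \<gamma>
      by (simp add: D.hval_def)
    show "grad_within (\<lambda>\<theta>. rhstar \<kappa> \<rho> \<Xi> l \<theta> \<gamma> \<xi>) \<Theta> \<theta> = fst (D.hgrad (\<theta>, \<gamma>) \<xi>)"
      "deriv (\<lambda>\<gamma>. rhstar \<kappa> \<rho> \<Xi> l \<theta> \<gamma> \<xi>) \<gamma> = snd (D.hgrad (\<theta>, \<gamma>) \<xi>)"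
      unfolding r using that Theta
      by (intro partial_gradientsI_quadratic[of \<Theta> \<theta> "{0<..}" \<gamma> "\<lambda>w. D.hval w \<xi>" _ "L / 2"]
          S.F_quadratic; simp add: space_Q)+
  qed
  have variance: "(\<integral>\<xi>. (norm (S.mean_grad w - D.hgrad w \<xi>))\<^sup>2 \<partial>Q) \<le> \<sigma>t\<^sup>2 + \<sigma>g\<^sup>2" if w: "w \<in> ?W" for w
  proof -
    obtain \<theta> \<gamma> where w_eq: "w = (\<theta>, \<gamma>)" and dom: "\<theta> \<in> \<Theta>" "0 < \<gamma>" using w by auto
    have "(\<integral>\<xi>. (norm (S.mean_grad w - D.hgrad w \<xi>))\<^sup>2 \<partial>Q)
      = (\<integral>\<xi>. (norm (fst (S.mean_grad w) - fst (D.hgrad w \<xi>)))\<^sup>2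
          + (norm (snd (S.mean_grad w) - snd (D.hgrad w \<xi>)))\<^sup>2 \<partial>Q)"
      by (simp add: norm_prod_def)
    also have "\<dots> = (\<integral>\<xi>. (norm (fst (S.mean_grad w) - fst (D.hgrad w \<xi>)))\<^sup>2 \<partial>Q)
        + (\<integral>\<xi>. (norm (snd (S.mean_grad w) - snd (D.hgrad w \<xi>)))\<^sup>2 \<partial>Q)"
      by (intro Bochner_Integration.integral_add S.squared_deviation_integrable w bounded_linear_fst bounded_linear_snd)
    also have "(\<integral>\<xi>. (norm (fst (S.mean_grad w) - fst (D.hgrad w \<xi>)))\<^sup>2 \<partial>Q)
      = (\<integral>\<xi>. (norm (grad_within (\<lambda>\<theta>. H \<theta> \<gamma>) \<Theta> \<theta>
                     - grad_within (\<lambda>\<theta>. rhstar \<kappa> \<rho> \<Xi> l \<theta> \<gamma> \<xi>) \<Theta> \<theta>))\<^sup>2 \<partial>Q)"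
      by (intro Bochner_Integration.integral_cong refl) (simp add: H_grad h_grad dom space_Q w_eq)
    also have "(\<integral>\<xi>. (norm (snd (S.mean_grad w) - snd (D.hgrad w \<xi>)))\<^sup>2 \<partial>Q)
      = (\<integral>\<xi>. (norm (deriv (\<lambda>\<gamma>. H \<theta> \<gamma>) \<gamma> - deriv (\<lambda>\<gamma>. rhstar \<kappa> \<rho> \<Xi> l \<theta> \<gamma> \<xi>) \<gamma>))\<^sup>2 \<partial>Q)"
      by (intro Bochner_Integration.integral_cong refl) (simp add: H_grad h_grad dom space_Q w_eq)
    finally show ?thesis using A4_theta[OF dom] A4_gamma[OF dom] by linarith
  qed
  have mean_gap: "S.mean (\<theta>0, \<gamma>0) - S.mean w \<le> \<Lambda>" if w: "w \<in> ?W" for w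
  proof -
    \<comment> \<open>The infimum is taken in \<open>ereal\<close>, so \<open>gap\<close> itself
      excludes the value -\<infinity>; here the infimum serves just as a lower bound.\<close>
    have inf: "(INF (\<theta>, \<gamma>)\<in>?W. ereal (H \<theta> \<gamma>)) \<le> ereal (S.mean w)"
      using w by (intro INF_lower2[OF w]) (auto simp: H_eq)
    show ?thesis
      using order_trans[OF ereal_minus_mono[OF order_refl inf] gap] by (simp add: H_eq)
  qed
  note run = run[unfolded da_sgd_run_def]
  interpret M: prob_space M using run by blast
  define w where "w t \<omega> = (th t \<omega>, ga t \<omega>)" for t \<omega>
  have w_measurable: "w t \<in> borel_measurable M" if "t \<le> T" for t
    using run that unfolding w_def by (intro borel_measurable_Pair) auto
  have dom: "th t \<omega> \<in> \<Theta>" "0 < ga t \<omega>" if "t \<le> T" "\<omega> \<in> space M" for t \<omega>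
    using run that by auto
  have w_in: "w t \<omega> \<in> ?W" if "t \<le> T" "\<omega> \<in> space M" for t \<omega>
    using dom[OF that] by (simp add: w_def)
  have X_measurable: "X t \<in> measurable M Q" "Xh t \<in> measurable M Q" "distr M Q (X t) = Q"
    if "t < T" for t using run that by auto
  have indep: "M.indep_set (sets (vimage_algebra (space M) (w t) (restrict_space borel ?W)))
      (sets (vimage_algebra (space M) (X t) Q))" if t: "t < T" for t
  proof -
    \<comment> \<open>The run asserts independence from the whole past. The iterate
      \<open>w t\<close> is one coordinate of that past and stays in \<open>?W\<close>, so it
      generates a smaller sigma-algebra.\<close>
    let ?P = "\<lambda>\<omega>. (\<lambda>s\<in>{..t}. (th s \<omega>, ga s \<omega>), \<lambda>s\<in>{..<t}. (X s \<omega>, Xh s \<omega>))"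
    let ?N = "PiM {..t} (\<lambda>_. borel \<Otimes>\<^sub>M borel) \<Otimes>\<^sub>M PiM {..<t} (\<lambda>_. Q \<Otimes>\<^sub>M Q)
      :: ((nat \<Rightarrow> (real ^ 'k) \<times> real) \<times> (nat \<Rightarrow> ((real ^ 'p) \<times> (real ^ 'm)) \<times> ((real ^ 'p) \<times> (real ^ 'm)))) measure"
    have past: "M.indep_set (sets (vimage_algebra (space M) ?P ?N)) (sets (vimage_algebra (space M) (X t) Q))"
      using run t by blast
    have "?P \<omega> \<in> space ?N" if "\<omega> \<in> space M" for \<omega>
      using t that measurable_space[OF X_measurable(1)] measurable_space[OF X_measurable(2)]
      by (auto simp: space_pair_measure space_PiM)
    then have "?P \<in> measurable (vimage_algebra (space M) ?P ?N) ?N"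
      by (intro measurable_vimage_algebra1) auto
    moreover have "(\<lambda>z. fst z t) \<in> measurable ?N (borel \<Otimes>\<^sub>M borel)"
      by (intro measurable_compose[OF measurable_fst] measurable_component_singleton) simp
    ultimately have "(\<lambda>\<omega>. fst (?P \<omega>) t) \<in> measurable (vimage_algebra (space M) ?P ?N) (borel \<Otimes>\<^sub>M borel)"
      by (rule measurable_compose)
    then have "w t \<in> measurable (vimage_algebra (space M) ?P ?N) borel"
      by (simp add: w_def[abs_def] borel_prod)
    then have "w t \<in> measurable (vimage_algebra (space M) ?P ?N) (restrict_space borel ?W)"
      using w_in t by (intro measurable_restrict_space2) auto
    then have "sets (vimage_algebra (space M) (w t) (restrict_space borel ?W))
        \<subseteq> sets (vimage_algebra (space M) ?P ?N)"
      using measurable_sets[of "w t" "vimage_algebra (space M) ?P ?N"] w_in t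
      by (subst sets_vimage_algebra2) (auto simp: space_restrict_space)
    then show ?thesis using M.indep_set_mono[OF past] by blast
  qed
  have \<alpha>: "0 < \<alpha>" "\<alpha> * L \<le> 1"
  proof -
    show "0 < \<alpha>" unfolding alpha using Lambda well_defined T_pos by (intro real_sqrt_gt_zero divide_pos_pos mult_pos_pos) auto
    show "\<alpha> * L \<le> 1" using step_le well_defined(1) by (simp add: pos_le_divide_eq)
  qed
  have step: "(norm ((1 / \<alpha>) *\<^sub>R (w t \<omega> - w (Suc t) \<omega>) - D.hgrad (w t \<omega>) (X t \<omega>)))\<^sup>2 \<le> 2 / sqrt (real T)"
    if t: "t < T" and \<omega>: "\<omega> \<in> space M" for t \<omega>
  proof -
    have Xs: "X t \<omega> \<in> \<Xi>" "Xh t \<omega> \<in> \<Xi>"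
      using measurable_space[OF X_measurable(1)[OF t] \<omega>] measurable_space[OF X_measurable(2)[OF t] \<omega>]
      by (simp_all add: space_Q)
    note d = dom[OF less_imp_le[OF t] \<omega>]
    have acc: "\<bar>hstar \<kappa> \<rho> \<Xi> l (th t \<omega>) (ga t \<omega>) (X t \<omega>)
        - hfun \<kappa> \<rho> l (th t \<omega>) (ga t \<omega>) (X t \<omega>) (Xh t \<omega>)\<bar> \<le> ereal \<epsilon>"
      and th: "th (Suc t) \<omega> = th t \<omega> - \<alpha> *\<^sub>R grad_within (\<lambda>\<theta>. l \<theta> (Xh t \<omega>)) \<Theta> (th t \<omega>)"
      and ga: "ga (Suc t) \<omega> = ga t \<omega> - \<beta> * (\<rho> - real_of_ereal (tcost \<kappa> (Xh t \<omega>) (X t \<omega>)))"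
      using run t \<omega> by blast+
    \<comment> \<open>The run uses a gradient given by definite description; it agrees with the
      field \<open>gt\<close> because gradients within a convex set with interior points are
      unique.\<close>
    have "grad_within (\<lambda>\<theta>. l \<theta> (Xh t \<omega>)) \<Theta> (th t \<omega>) = gt (th t \<omega>) (Xh t \<omega>)"
      by (rule grad_within_eqI[OF Theta d(1) D.grad_theta[OF d(1) Xs(2)]])
    then have "(1 / \<alpha>) *\<^sub>R (w t \<omega> - w (Suc t) \<omega>)
        = (gt (th t \<omega>) (Xh t \<omega>), \<rho> - real_of_ereal (tcost \<kappa> (Xh t \<omega>) (X t \<omega>)))"
      using \<alpha>(1) by (simp add: w_def th ga beta)
    then have "(norm ((1 / \<alpha>) *\<^sub>R (w t \<omega> - w (Suc t) \<omega>) - D.hgrad (w t \<omega>) (X t \<omega>)))\<^sup>2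
        \<le> (Ltx\<^sup>2 + 1) * (2 * \<epsilon> / \<mu>)"
      using D.hgrad_error[OF d Xs acc] by (simp add: w_def)
    also have "\<dots> = 2 / sqrt (real T)"
    proof -
      have "A * (2 * (\<mu> / (A * q)) / \<mu>) = 2 / q" if "A \<noteq> 0" for A q :: real
        using that mu by simp
      moreover have "Ltx\<^sup>2 + 1 \<noteq> 0" using zero_le_power2[of Ltx] by linarith
      ultimately show ?thesis unfolding eps by blast
    qed
    finally show ?thesis .
  qed
  have w_0: "w 0 \<omega> = (\<theta>0, \<gamma>0)" if "\<omega> \<in> space M" for \<omega>
    using run that by (simp add: w_def)
  have grad_norm: "(norm (grad_within (\<lambda>\<theta>. H \<theta> (ga t \<omega>)) \<Theta> (th t \<omega>)))\<^sup>2
      + (norm (deriv (\<lambda>\<gamma>. H (th t \<omega>) \<gamma>) (ga t \<omega>)))\<^sup>2 = (norm (S.mean_grad (w t \<omega>)))\<^sup>2"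
    if "t < T" "\<omega> \<in> space M" for t \<omega>
    using dom[of t \<omega>] that by (simp add: H_grad w_def norm_prod_def)
  show ?thesis
  proof (intro conjI allI impI)
    fix t assume t: "t < T"
    have "integrable M (\<lambda>\<omega>. (norm (S.mean_grad (w t \<omega>)))\<^sup>2)"
      using w_measurable w_in w_0 X_measurable(1,3) indep step variance mean_gap \<alpha> t
      by (rule S.biased_sgd(1)[OF M.prob_space_axioms])
    then show "integrable M (\<lambda>\<omega>.
             (norm (grad_within (\<lambda>\<theta>. H \<theta> (ga t \<omega>)) \<Theta> (th t \<omega>)))\<^sup>2
           + (norm (deriv (\<lambda>\<gamma>. H (th t \<omega>) \<gamma>) (ga t \<omega>)))\<^sup>2)"
      using grad_norm[OF t] by (simp cong: Bochner_Integration.integrable_cong)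
  next
    have "1 / real T * (\<Sum>t<T. \<integral>\<omega>.
             (norm (grad_within (\<lambda>\<theta>. H \<theta> (ga t \<omega>)) \<Theta> (th t \<omega>)))\<^sup>2
           + (norm (deriv (\<lambda>\<gamma>. H (th t \<omega>) \<gamma>) (ga t \<omega>)))\<^sup>2 \<partial>M)
      = 1 / real T * (\<Sum>t<T. \<integral>\<omega>. (norm (S.mean_grad (w t \<omega>)))\<^sup>2 \<partial>M)"
      by (intro arg_cong2[of _ _ _ _ "(*)"] refl sum.cong Bochner_Integration.integral_cong grad_norm) auto
    also have "\<dots> \<le> 1 / real T * (2 * \<Lambda> / \<alpha> + real T * (2 / sqrt (real T) + 2 * L * \<alpha> * (\<sigma>t\<^sup>2 + \<sigma>g\<^sup>2)
        + L * \<alpha> * (2 / sqrt (real T))))"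
      by (rule mult_left_mono[OF S.biased_sgd(2)[OF M.prob_space_axioms w_measurable w_in w_0
        X_measurable(1,3) indep step variance mean_gap \<alpha>]]) simp_all
    also have "\<dots> = (4 * sqrt (L * (\<sigma>t\<^sup>2 + \<sigma>g\<^sup>2) * \<Lambda>) + 2) * sqrt (1 / real T)
            + 2 * sqrt (L * \<Lambda> / (\<sigma>t\<^sup>2 + \<sigma>g\<^sup>2)) * (1 / real T)"
      by (rule step_size_arithmetic[OF well_defined Lambda T_pos alpha refl])
    finally show "1 / real T * (\<Sum>t<T. \<integral>\<omega>.
             (norm (grad_within (\<lambda>\<theta>. H \<theta> (ga t \<omega>)) \<Theta> (th t \<omega>)))\<^sup>2
           + (norm (deriv (\<lambda>\<gamma>. H (th t \<omega>) \<gamma>) (ga t \<omega>)))\<^sup>2 \<partial>M)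
         \<le> (4 * sqrt (L * (\<sigma>t\<^sup>2 + \<sigma>g\<^sup>2) * \<Lambda>) + 2) * sqrt (1 / real T)
            + 2 * sqrt (L * \<Lambda> / (\<sigma>t\<^sup>2 + \<sigma>g\<^sup>2)) * (1 / real T)" .
  qed
qed

end
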